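(* Let $f$ and $g$ be transcendental entire functions of bounded type with $f\circ g=g\circ f$. Then $\overline{I(f)}\cup\overline{I(g)}\subset\overline{I(f\circ g)}$.
   Context: For an entire function $f$, $f^n$ denotes the $n$-th iterate and $I(f)=\{z\in\mathbb{C}: f^n(z)\to\infty\}$ is its escaping set; $\overline{E}$ denotes closure in $\mathbb{C}$. A transcendental entire function is of bounded type if the set of its critical values and finite asymptotic values, together with their finite limit points, is bounded. *)

theory Defs
  imports "HOL-Analysis.Analysis" "HOL-Computational_Algebra.Polynomial"
begin

definition entire :: "(complex \<Rightarrow> complex) \<Rightarrow> bool" where
  "entire f \<longleftrightarrow> f holomorphic_on UNIV"

definition transcendental_entire :: "(complex \<Rightarrow> complex) \<Rightarrow> bool" where
  "transcendental_entire f \<longleftrightarrow> entire f \<and> \<not> (\<exists>p. \<forall>z. f z = poly p z)"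

definition critical_values :: "(complex \<Rightarrow> complex) \<Rightarrow> complex set" where
  "critical_values f = {f z | z. deriv f z = 0}"

definition asymptotic_values :: "(complex \<Rightarrow> complex) \<Rightarrow> complex set" where
  "asymptotic_values f = {a. \<exists>\<gamma> :: real \<Rightarrow> complex.
      continuous_on {0..<1} \<gamma> \<and>
      filterlim \<gamma> at_infinity (at_left 1) \<and>
      ((f \<circ> \<gamma>) \<longlongrightarrow> a) (at_left 1)}"

definition bounded_type :: "(complex \<Rightarrow> complex) \<Rightarrow> bool" where
  "bounded_type f \<longleftrightarrow> transcendental_entire f \<and>
     bounded (closure (critical_values f \<union> asymptotic_values f))"

definition escaping_set :: "(complex \<Rightarrow> complex) \<Rightarrow> complex set" where
  "escaping_set f = {z. filterlim (\<lambda>n. (f ^^ n) z) at_infinity sequentially}"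

end

theory Submission
  imports Defs "HOL-Complex_Analysis.Complex_Analysis" "HOL-Real_Asymp.Real_Asymp"
begin

text \<open>
  Write \<open>h = f \<circ> g\<close> and let \<open>F\<close> be the complement of the closure of \<open>I(h)\<close>. Since \<open>f\<close> commutes with
  \<open>h\<close> and is bounded on bounded sets, \<open>f z \<in> I(h)\<close> implies \<open>z \<in> I(h)\<close>; hence the open map \<open>f\<close> sends \<open>F\<close>
  into itself, and the iterates of \<open>f\<close> on \<open>F\<close> omit \<open>I(h)\<close>. If \<open>F\<close> contained a point of \<open>I(f)\<close>, then
  Schottky's theorem would give a disc on which all late iterates of \<open>f\<close> are large, so that their
  logarithms map it into a half-plane. The Schwarz lemma bounds the derivatives of these logarithms,
  whereas the Eremenko-Lyubich expansion estimate
  \<open>|f'(z)| \<ge> |f z| (ln |f z| - ln R) / (12 \<pi> |z|)\<close> makes them too large.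

  The expansion estimate comes from lifting \<open>exp\<close> through \<open>f\<close>: outside a disc containing the singular
  values \<open>f\<close> is a covering, the lift to a half-plane is injective because \<open>f\<close> is not a polynomial,
  and so by Bloch's theorem its logarithm, whose image contains no disc of radius greater than \<open>\<pi>\<close>,
  has small derivative. The same estimate yields a point of \<open>I(h)\<close>: a neighbourhood of a maximum
  modulus point is mapped over a full annulus, which contains the next maximum modulus point.
\<close>

subsection \<open>Inverse branches\<close>

text \<open>The identity \<open>f (\<tau> w) = w\<close> on a disc about \<open>f p\<close> serves
  to continue inverse branches, while \<open>\<tau> (f z) = z\<close> near \<open>p\<close> serves
  to recognise a given lift as \<open>\<tau>\<close> composed with its projection.\<close>

lemma holomorphic_local_inverse:
  fixes f :: "complex \<Rightarrow> complex"
  assumes "f holomorphic_on UNIV" "deriv f p \<noteq> 0"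
  obtains e \<tau> N where "e > 0" "open N" "p \<in> N" "\<tau> holomorphic_on ball (f p) e"
    "\<And>w. w \<in> ball (f p) e \<Longrightarrow> f (\<tau> w) = w" "\<And>z. z \<in> N \<Longrightarrow> \<tau> (f z) = z"
proof -
  obtain r where r: "r > 0" "open (f ` ball p r)" "inj_on f (ball p r)"
    using has_complex_derivative_locally_invertible[OF assms(1) _ _ assms(2)] by auto
  have "f holomorphic_on ball p r"
    using assms(1) holomorphic_on_subset by blast
  then obtain g where g: "g holomorphic_on f ` ball p r" "\<And>z. z \<in> ball p r \<Longrightarrow> g (f z) = z"
    using holomorphic_has_inverse[of f "ball p r"] r(3) by blast
  have "f p \<in> f ` ball p r" using r(1) by simp
  then obtain e where e: "e > 0" "ball (f p) e \<subseteq> f ` ball p r"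
    using r(2) open_contains_ball by blast
  show thesis
  proof (rule that[of e "ball p r" g])
    show "g holomorphic_on ball (f p) e" using g(1) e(2) holomorphic_on_subset by blast
    show "f (g w) = w" if "w \<in> ball (f p) e" for w using that e(2) g(2) by fastforce
  qed (use e r g in auto)
qed

text \<open>Near the noncritical point \<open>h a\<close> the map \<open>f\<close> is injective, so
  two lifts of the same function that agree at \<open>a\<close> agree on a neighbourhood of
  \<open>a\<close>; the identity theorem carries this over the connected set
  \<open>T\<close>.\<close>

lemma holomorphic_lift_unique:
  fixes f :: "complex \<Rightarrow> complex"
  assumes f: "f holomorphic_on UNIV" and T: "open T" "connected T"
    and h: "h holomorphic_on T" "k holomorphic_on T"
    and eq: "\<And>w. w \<in> T \<Longrightarrow> f (h w) = f (k w)"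
    and a: "a \<in> T" "h a = k a" "deriv f (h a) \<noteq> 0" and "w \<in> T"
  shows "h w = k w"
proof -
  obtain \<tau> N where N: "open N" "h a \<in> N" "\<And>z. z \<in> N \<Longrightarrow> \<tau> (f z) = z"
    using holomorphic_local_inverse[OF f a(3)] by metis
  define S where "S = (T \<inter> h -` N) \<inter> (T \<inter> k -` N)"
  have "open S" unfolding S_def
    using h T N holomorphic_on_imp_continuous_on
    by (intro open_Int continuous_open_preimage) auto
  moreover have "a \<in> S" using a N by (auto simp: S_def)
  moreover have "h z = k z" if "z \<in> S" for z
    using that N(3) eq[of z] unfolding S_def by (metis IntD1 IntD2 vimageE)
  ultimately show ?thesis
    using analytic_continuation_open[of S T h k w] T h \<open>w \<in> T\<close> by (auto simp: S_def)
qed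

text \<open>Chain rule applied to \<open>f \<circ> \<tau> = id\<close>: the product of the two
  derivatives is 1.\<close>

lemma deriv_nonzero_at_right_inverse:
  fixes f :: "complex \<Rightarrow> complex"
  assumes f: "f holomorphic_on UNIV" and \<tau>: "\<tau> holomorphic_on T" "open T"
    and eq: "\<And>w. w \<in> T \<Longrightarrow> f (\<tau> w) = w" and "a \<in> T"
  shows "deriv f (\<tau> a) \<noteq> 0"
proof -
  have "(\<tau> has_field_derivative deriv \<tau> a) (at a)"
    using \<tau> \<open>a \<in> T\<close> holomorphic_derivI by blast
  moreover have "(f has_field_derivative deriv f (\<tau> a)) (at (\<tau> a))"
    using f holomorphic_derivI open_UNIV by blast
  ultimately have "((\<lambda>w. f (\<tau> w)) has_field_derivative deriv f (\<tau> a) * deriv \<tau> a) (at a)"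
    using DERIV_chain2 by blast
  moreover have "((\<lambda>w. f (\<tau> w)) has_field_derivative 1) (at a)"
    by (rule has_field_derivative_transform_within_open[OF DERIV_ident \<tau>(2) \<open>a \<in> T\<close>])
      (use eq in auto)
  ultimately have "deriv f (\<tau> a) * deriv \<tau> a = 1" using DERIV_unique by blast
  then show ?thesis by auto
qed

lemma holomorphic_glue:
  fixes F :: "'i \<Rightarrow> complex \<Rightarrow> complex"
  assumes "\<And>i. i \<in> I \<Longrightarrow> open (T i)" "\<And>i. i \<in> I \<Longrightarrow> F i holomorphic_on T i"
    and agree: "\<And>i j w. i \<in> I \<Longrightarrow> j \<in> I \<Longrightarrow> w \<in> T i \<Longrightarrow> w \<in> T j \<Longrightarrow> F i w = F j w"
  obtains s where "s holomorphic_on (\<Union>i\<in>I. T i)" "\<And>i w. i \<in> I \<Longrightarrow> w \<in> T i \<Longrightarrow> s w = F i w"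
proof -
  define s where "s w = F (SOME i. i \<in> I \<and> w \<in> T i) w" for w
  have s: "s w = F i w" if "i \<in> I" "w \<in> T i" for i w
  proof -
    have "(SOME i. i \<in> I \<and> w \<in> T i) \<in> I \<and> w \<in> T (SOME i. i \<in> I \<and> w \<in> T i)"
      by (rule someI[of _ i]) (use that in auto)
    then show ?thesis using agree that unfolding s_def by blast
  qed
  have "s holomorphic_on T i" if "i \<in> I" for i
    by (rule holomorphic_transform[OF assms(2)[OF that]]) (use s that in auto)
  then have "s holomorphic_on (\<Union>i\<in>I. T i)"
    using assms(1) by (intro holomorphic_on_UN_open) auto
  then show thesis using that s by blast
qed

text \<open>The branch maps the radius ending at \<open>b\<close> to a curve along which
  \<open>f\<close> tends to \<open>b\<close>. Since \<open>b\<close> is no asymptotic value, the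
  curve returns to a bounded set arbitrarily late and accumulates at some \<open>p\<close> with
  \<open>f p = b\<close>. Since \<open>b\<close> is no critical value, \<open>f\<close> has a local
  inverse at \<open>p\<close>, and this is the extension.\<close>

lemma inverse_branch_extends_across_boundary:
  fixes f :: "complex \<Rightarrow> complex"
  assumes f: "f holomorphic_on UNIV" and "r > 0"
    and \<sigma>: "\<sigma> holomorphic_on ball w0 r" "\<And>w. w \<in> ball w0 r \<Longrightarrow> f (\<sigma> w) = w"
    and b: "dist w0 b = r" "b \<notin> critical_values f" "b \<notin> asymptotic_values f"
  obtains e \<tau> where "e > 0" "\<tau> holomorphic_on ball b e"
    "\<And>w. w \<in> ball b e \<Longrightarrow> f (\<tau> w) = w"
    "\<And>w. w \<in> ball b e \<Longrightarrow> w \<in> ball w0 r \<Longrightarrow> \<tau> w = \<sigma> w"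
proof -
  define l where "l t = w0 + of_real t * (b - w0)" for t :: real
  define \<gamma> where "\<gamma> = \<sigma> \<circ> l"
  have l_in: "l t \<in> ball w0 r" if "t \<in> {0..<1}" for t
    using that b(1) \<open>r > 0\<close> by (simp add: l_def dist_norm norm_mult norm_minus_commute)
  have l_cont: "continuous_on A l" for A
    unfolding l_def by (intro continuous_intros)
  have "continuous_on (l ` {0..<1}) \<sigma>"
    by (rule continuous_on_subset[OF holomorphic_on_imp_continuous_on[OF \<sigma>(1)]]) (use l_in in blast)
  then have \<gamma>_cont: "continuous_on {0..<1} \<gamma>"
    unfolding \<gamma>_def by (rule continuous_on_compose[OF l_cont])
  have f\<gamma>: "f (\<gamma> t) = l t" if "t \<in> {0..<1}" for t
    using \<sigma>(2) l_in[OF that] by (simp add: \<gamma>_def)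
  have l1: "l 1 = b" by (simp add: l_def)
  have llim: "(l \<longlongrightarrow> b) (at_left 1)"
    using l_cont[of UNIV] l1 by (metis continuous_on_eq_continuous_at continuous_at_imp_continuous_at_within open_UNIV UNIV_I continuous_within)
  have ev01: "eventually (\<lambda>t::real. t \<in> {0..<1}) (at_left 1)"
    by (rule eventually_at_leftI[of 0]) auto
  have flim: "((f \<circ> \<gamma>) \<longlongrightarrow> b) (at_left 1)"
    by (rule Lim_transform_eventually[OF llim]) (use ev01 f\<gamma> in \<open>auto elim!: eventually_mono\<close>)
  \<comment> \<open>Otherwise the curve \<open>\<gamma>\<close> itself would exhibit
    \<open>b\<close> as an asymptotic value.\<close>
  have "\<not> filterlim \<gamma> at_infinity (at_left 1)"
    using b(3) \<gamma>_cont flim unfolding asymptotic_values_def by auto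
  then obtain M where M: "\<not> eventually (\<lambda>t. M \<le> norm (\<gamma> t)) (at_left 1)"
    unfolding filterlim_at_infinity[OF order_refl] by blast
  have "\<exists>t. t \<in> {0..<1} \<and> 1 - 1 / real (Suc n) < t \<and> norm (\<gamma> t) < M" for n
  proof (rule ccontr)
    assume *: "\<not> ?thesis"
    have "eventually (\<lambda>t. t \<in> {max 0 (1 - 1 / real (Suc n))<..<1}) (at_left 1)"
      by (rule eventually_at_leftI[of "max 0 (1 - 1 / real (Suc n))"]) auto
    then have "eventually (\<lambda>t. M \<le> norm (\<gamma> t)) (at_left 1)"
      by (rule eventually_mono) (use * in \<open>meson atLeastLessThan_iff greaterThanLessThan_iff
          less_imp_le linorder_not_le max_less_iff_conj\<close>)
    then show False using M by blast
  qed
  then obtain t where t: "\<And>n. t n \<in> {0..<1}" "\<And>n. 1 - 1 / real (Suc n) < t n" "\<And>n. norm (\<gamma> (t n)) < M"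
    by metis
  have tlim: "t \<longlonglongrightarrow> 1"
  proof (rule tendsto_sandwich[of "\<lambda>n. 1 - 1 / real (Suc n)" _ _ "\<lambda>n. 1"])
    show "(\<lambda>n. 1 - 1 / real (Suc n)) \<longlonglongrightarrow> 1"
      using tendsto_diff[OF tendsto_const[of 1] LIMSEQ_inverse_real_of_nat] by (simp add: field_simps)
  qed (use t in \<open>auto intro!: always_eventually less_imp_le\<close>)
  have "\<forall>n. \<gamma> (t n) \<in> cball 0 M" using t(3) by (simp add: less_imp_le)
  then obtain p \<phi> where p: "strict_mono (\<phi> :: nat \<Rightarrow> nat)" "(\<lambda>n. \<gamma> (t (\<phi> n))) \<longlonglongrightarrow> p"
    using spec[OF compact_cball[of "0::complex" M, unfolded compact_def], of "\<lambda>n. \<gamma> (t n)"]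
    by (auto simp: o_def)
  have tlim': "(\<lambda>n. t (\<phi> n)) \<longlonglongrightarrow> 1"
    using LIMSEQ_subseq_LIMSEQ[OF tlim p(1)] by (simp add: o_def)
  have llim': "(\<lambda>n. l (t (\<phi> n))) \<longlonglongrightarrow> b"
    using continuous_on_tendsto_compose[OF l_cont[of UNIV] tlim'] l1 by simp
  have "(\<lambda>n. f (\<gamma> (t (\<phi> n)))) \<longlonglongrightarrow> f p"
    using continuous_on_tendsto_compose[OF holomorphic_on_imp_continuous_on[OF f] p(2)] by simp
  then have "(\<lambda>n. l (t (\<phi> n))) \<longlonglongrightarrow> f p" using f\<gamma> t(1) by simp
  then have fp: "f p = b" using llim' LIMSEQ_unique by blast
  have dp: "deriv f p \<noteq> 0" using b(2) fp unfolding critical_values_def by blast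
  obtain e \<tau> N where N: "e > 0" "open N" "p \<in> N" "\<tau> holomorphic_on ball b e"
    "\<And>w. w \<in> ball b e \<Longrightarrow> f (\<tau> w) = w" "\<And>z. z \<in> N \<Longrightarrow> \<tau> (f z) = z"
    using holomorphic_local_inverse[OF f dp] fp by metis
  have "eventually (\<lambda>n. \<gamma> (t (\<phi> n)) \<in> N) sequentially"
    using p(2) N(2,3) topological_tendstoD by blast
  moreover have "eventually (\<lambda>n. l (t (\<phi> n)) \<in> ball b e) sequentially"
    using topological_tendstoD[OF llim' open_ball, of b e] \<open>e > 0\<close> by simp
  ultimately have "eventually (\<lambda>n. \<gamma> (t (\<phi> n)) \<in> N \<and> l (t (\<phi> n)) \<in> ball b e) sequentially"
    by (rule eventually_conj)
  then obtain n where n: "\<gamma> (t (\<phi> n)) \<in> N" "l (t (\<phi> n)) \<in> ball b e"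
    unfolding eventually_sequentially by blast
  \<comment> \<open>At this point of the radius, \<open>\<gamma>\<close> lies in the neighbourhood
    where \<open>\<tau>\<close> inverts \<open>f\<close> from the left, so both branches take the
    same value; uniqueness of lifts on the convex overlap of the two discs does the rest.\<close>
  define a where "a = l (t (\<phi> n))"
  have a: "a \<in> ball b e" "a \<in> ball w0 r" "\<tau> a = \<sigma> a"
    using n l_in[OF t(1)] N(6)[OF n(1)] f\<gamma>[OF t(1)] by (auto simp: a_def \<gamma>_def)
  have nz: "deriv f (\<tau> a) \<noteq> 0"
    by (rule deriv_nonzero_at_right_inverse[OF f N(4) open_ball N(5) a(1)])
  show thesis
  proof (rule that[OF N(1,4,5)])
    fix w assume w: "w \<in> ball b e" "w \<in> ball w0 r"
    show "\<tau> w = \<sigma> w"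
    proof (rule holomorphic_lift_unique[OF f, of "ball b e \<inter> ball w0 r" \<tau> \<sigma> a])
      show "connected (ball b e \<inter> ball w0 r)" by (intro convex_connected convex_Int convex_ball)
      show "\<tau> holomorphic_on ball b e \<inter> ball w0 r" using N(4) holomorphic_on_subset by blast
      show "\<sigma> holomorphic_on ball b e \<inter> ball w0 r" using \<sigma>(1) holomorphic_on_subset by blast
    qed (use N \<sigma> a w nz in auto)
  qed
qed

text \<open>The local extensions at all boundary points are glued with the given branch into a
  branch on an open set containing the closed disc; by compactness that set contains a larger
  concentric disc.\<close>

lemma inverse_branch_extends:
  fixes f :: "complex \<Rightarrow> complex"
  assumes f: "f holomorphic_on UNIV" and "r > 0"
    and \<sigma>: "\<sigma> holomorphic_on ball w0 r" "\<And>w. w \<in> ball w0 r \<Longrightarrow> f (\<sigma> w) = w"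
    and free: "sphere w0 r \<inter> (critical_values f \<union> asymptotic_values f) = {}"
  obtains r' s where "r' > r" "s holomorphic_on ball w0 r'"
    "\<And>w. w \<in> ball w0 r' \<Longrightarrow> f (s w) = w" "s w0 = \<sigma> w0"
proof -
  define Q where "Q b e \<tau> \<longleftrightarrow> e > 0 \<and> \<tau> holomorphic_on ball b e \<and> (\<forall>w\<in>ball b e. f (\<tau> w) = w)
      \<and> (\<forall>w\<in>ball b e. w \<in> ball w0 r \<longrightarrow> \<tau> w = \<sigma> w)" for b e \<tau>
  have "\<exists>e \<tau>. Q b e \<tau>" if "b \<in> sphere w0 r" for b
  proof -
    have "dist w0 b = r" "b \<notin> critical_values f" "b \<notin> asymptotic_values f"
      using free that by auto
    then obtain e \<tau> where "e > 0" "\<tau> holomorphic_on ball b e"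
      "\<And>w. w \<in> ball b e \<Longrightarrow> f (\<tau> w) = w"
      "\<And>w. w \<in> ball b e \<Longrightarrow> w \<in> ball w0 r \<Longrightarrow> \<tau> w = \<sigma> w"
      using inverse_branch_extends_across_boundary[OF f \<open>r > 0\<close> \<sigma>] by blast
    then show ?thesis unfolding Q_def by blast
  qed
  then obtain e \<tau> where Q: "\<And>b. b \<in> sphere w0 r \<Longrightarrow> Q b (e b) (\<tau> b)"
    by metis
  have e: "e b > 0" if "b \<in> sphere w0 r" for b using Q[OF that] by (simp add: Q_def)
  have \<tau>: "\<tau> b holomorphic_on ball b (e b)"
      "w \<in> ball b (e b) \<Longrightarrow> f (\<tau> b w) = w"
      "w \<in> ball b (e b) \<Longrightarrow> w \<in> ball w0 r \<Longrightarrow> \<tau> b w = \<sigma> w" if "b \<in> sphere w0 r" for b w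
    using Q[OF that] unfolding Q_def by blast+
  \<comment> \<open>The radii are halved for gluing so that, when the half-discs about
    \<open>b\<close> and \<open>c\<close> meet, the centre \<open>c\<close> of the smaller disc lies
    in the full disc about \<open>b\<close>. The overlap of the full discs is then a neighbourhood
    of the boundary point \<open>c\<close>, hence meets the original disc, where both extensions
    equal \<open>\<sigma>\<close>.\<close>
  have agree1: "\<tau> b w = \<tau> c w"
    if b: "b \<in> sphere w0 r" and c: "c \<in> sphere w0 r" and le: "e c \<le> e b"
      and w: "w \<in> ball b (e b / 2)" "w \<in> ball c (e c / 2)" for b c w
  proof -
    have half: "dist b w < e b / 2" "dist c w < e c / 2" using w by auto
    have "dist b c < e b"
      using dist_triangle[of b c w] half le by (simp add: dist_commute)
    moreover have "c \<in> closure (ball w0 r)" using c \<open>r > 0\<close> by simp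
    moreover have "open (ball b (e b) \<inter> ball c (e c))" by blast
    ultimately have "ball b (e b) \<inter> ball c (e c) \<inter> ball w0 r \<noteq> {}"
      using e[OF c] open_Int_closure_eq_empty[of "ball b (e b) \<inter> ball c (e c)" "ball w0 r"] by auto
    then obtain a where a: "a \<in> ball b (e b)" "a \<in> ball c (e c)" "a \<in> ball w0 r" by blast
    show ?thesis
    proof (rule holomorphic_lift_unique[OF f, of "ball b (e b) \<inter> ball c (e c)" "\<tau> b" "\<tau> c" a])
      show "connected (ball b (e b) \<inter> ball c (e c))" by (intro convex_connected convex_Int convex_ball)
      show "\<tau> b holomorphic_on ball b (e b) \<inter> ball c (e c)"
        using \<tau>(1)[OF b] holomorphic_on_subset by blast
      show "\<tau> c holomorphic_on ball b (e b) \<inter> ball c (e c)"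
        using \<tau>(1)[OF c] holomorphic_on_subset by blast
      show "\<tau> b a = \<tau> c a" using \<tau>(3) b c a by simp
      show "deriv f (\<tau> b a) \<noteq> 0"
        by (rule deriv_nonzero_at_right_inverse[OF f \<tau>(1)[OF b] open_ball \<tau>(2)[OF b] a(1)])
    qed (use a \<tau>(2) b c half e[OF b] e[OF c] in \<open>auto simp del: mem_sphere\<close>)
  qed
  have agree2: "\<tau> b w = \<tau> c w"
    if "b \<in> sphere w0 r" "c \<in> sphere w0 r" "w \<in> ball b (e b / 2)" "w \<in> ball c (e c / 2)" for b c w
    using agree1[of b c w] agree1[of c b w] that by (cases "e c \<le> e b") auto
  have sub: "w \<in> ball b (e b)" if "b \<in> sphere w0 r" "w \<in> ball b (e b / 2)" for b w
    using that e[OF that(1)] by simp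
  \<comment> \<open>The index \<open>w0\<close>, which is not on the sphere, stands for the given branch.\<close>
  define T where "T b = (if b = w0 then ball w0 r else ball b (e b / 2))" for b
  define F where "F b = (if b = w0 then \<sigma> else \<tau> b)" for b
  define I where "I = insert w0 (sphere w0 r)"
  have w0: "w0 \<notin> sphere w0 r" using \<open>r > 0\<close> by simp
  have Iw: "b = w0 \<or> (b \<noteq> w0 \<and> b \<in> sphere w0 r)" if "b \<in> I" for b
    using that w0 unfolding I_def by blast
  obtain s where s: "s holomorphic_on (\<Union>b\<in>I. T b)" "\<And>b w. b \<in> I \<Longrightarrow> w \<in> T b \<Longrightarrow> s w = F b w"
  proof (rule holomorphic_glue[of I T F])
    show "open (T b)" for b by (simp add: T_def)
    show "F b holomorphic_on T b" if "b \<in> I" for b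
      using Iw[OF that] \<tau>(1)[of b] \<sigma>(1) sub[of b]
      by (auto simp: T_def F_def simp del: mem_sphere intro: holomorphic_on_subset)
    show "F b w = F c w" if "b \<in> I" "c \<in> I" "w \<in> T b" "w \<in> T c" for b c w
      using Iw[OF that(1)] Iw[OF that(2)] that(3,4) \<tau>(3)[of b w] \<tau>(3)[of c w] sub[of b w] sub[of c w]
        agree2[of b c w]
      by (auto simp: T_def F_def simp del: mem_sphere mem_ball)
  qed blast
  define \<Omega> where "\<Omega> = (\<Union>b\<in>I. T b)"
  have fs: "f (s w) = w" if "w \<in> \<Omega>" for w
  proof -
    obtain b where b: "b \<in> I" "w \<in> T b" using \<open>w \<in> \<Omega>\<close> unfolding \<Omega>_def by blast
    then show ?thesis
      using Iw[OF b(1)] s(2)[OF b] \<tau>(2)[of b w] \<sigma>(2)[of w] sub[of b w]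
      by (auto simp: T_def F_def simp del: mem_sphere mem_ball)
  qed
  have "open \<Omega>" by (auto simp: \<Omega>_def T_def)
  have cb: "cball w0 r \<subseteq> \<Omega>"
  proof
    fix w assume "w \<in> cball w0 r"
    then consider "w \<in> ball w0 r" | "w \<in> sphere w0 r" by fastforce
    then show "w \<in> \<Omega>"
    proof cases
      case 1 then show ?thesis by (auto simp: \<Omega>_def I_def T_def)
    next
      case 2 
      then have "w \<in> T w" "w \<in> I" using e[OF 2] w0 by (auto simp: T_def I_def)
      then show ?thesis unfolding \<Omega>_def by blast
    qed
  qed
  obtain d where d: "d > 0" "(\<Union>x\<in>cball w0 r. ball x d) \<subseteq> \<Omega>"
    using compact_subset_open_imp_ball_epsilon_subset[OF compact_cball \<open>open \<Omega>\<close> cb] by blast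
  have sub': "ball w0 (r + d) \<subseteq> \<Omega>"
  proof
    fix w assume w: "w \<in> ball w0 (r + d)"
    show "w \<in> \<Omega>"
    proof (cases "w \<in> cball w0 r")
      case True then show ?thesis using cb by blast
    next
      case False
      \<comment> \<open>The radial projection of \<open>w\<close> to the sphere, at distance less
        than \<open>d\<close> from \<open>w\<close>.\<close>
      define x where "x = w0 + of_real (r / dist w0 w) * (w - w0)"
      have n: "norm (w - w0) > r" using False by (simp add: dist_norm norm_minus_commute)
      then have "w \<noteq> w0" using \<open>r > 0\<close> by auto
      have "w - x = of_real (1 - r / dist w0 w) * (w - w0)" by (simp add: x_def algebra_simps)
      then have "norm (w - x) = (1 - r / norm (w - w0)) * norm (w - w0)"
        using n \<open>r > 0\<close> by (simp only: norm_mult norm_of_real) (auto simp: dist_norm norm_minus_commute abs_if field_simps)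
      also have "\<dots> = norm (w - w0) - r" using \<open>w \<noteq> w0\<close> by (simp add: field_simps)
      also have "\<dots> < d" using w by (simp add: dist_norm norm_minus_commute)
      finally have "w \<in> ball x d" by (simp add: dist_norm norm_minus_commute)
      moreover have "norm (x - w0) = r"
        using \<open>w \<noteq> w0\<close> \<open>r > 0\<close> by (simp add: x_def norm_mult dist_norm norm_minus_commute norm_divide del: of_real_divide)
      then have "x \<in> cball w0 r" by (simp add: dist_norm norm_minus_commute)
      ultimately show ?thesis using d(2) by blast
    qed
  qed
  show thesis
  proof (rule that[of "r + d" s])
    show "s holomorphic_on ball w0 (r + d)"
      using s(1) sub' holomorphic_on_subset unfolding \<Omega>_def by blast
    show "s w0 = \<sigma> w0" using s(2)[of w0 w0] \<open>r > 0\<close> by (simp add: I_def T_def F_def)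
  qed (use d fs sub' in auto)
qed

text \<open>Continuation in the radius: branches on concentric discs with the same value at the
  centre agree, so they glue up to the supremum \<open>R\<close> of the admissible radii. If
  \<open>R < \<rho>\<close>, the sphere of radius \<open>R\<close> is free of singular values and
  the branch extends further, a contradiction.\<close>

lemma inverse_branch_on_ball:
  fixes f :: "complex \<Rightarrow> complex"
  assumes f: "f holomorphic_on UNIV" and "\<rho> > 0"
    and free: "ball w0 \<rho> \<inter> (critical_values f \<union> asymptotic_values f) = {}"
    and z0: "f z0 = w0"
  obtains \<sigma> where "\<sigma> holomorphic_on ball w0 \<rho>" "\<And>w. w \<in> ball w0 \<rho> \<Longrightarrow> f (\<sigma> w) = w" "\<sigma> w0 = z0"
proof -
  define br where "br r \<sigma> \<longleftrightarrow> \<sigma> holomorphic_on ball w0 r \<and> (\<forall>w\<in>ball w0 r. f (\<sigma> w) = w) \<and> \<sigma> w0 = z0"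
    for r \<sigma>
  define S where "S = {r. 0 < r \<and> r \<le> \<rho> \<and> (\<exists>\<sigma>. br r \<sigma>)}"
  have br_mono: "br r \<sigma>" if "br r' \<sigma>" "r \<le> r'" for r r' \<sigma>
    using that subset_ball[OF that(2)] unfolding br_def by (meson holomorphic_on_subset subsetD)
  have "w0 \<notin> critical_values f" using free centre_in_ball[of w0 \<rho>] \<open>\<rho> > 0\<close> by blast
  then have d0: "deriv f z0 \<noteq> 0" using z0 unfolding critical_values_def by blast
  obtain e \<tau> N where e: "e > 0" "z0 \<in> N" "\<tau> holomorphic_on ball w0 e"
    "\<And>w. w \<in> ball w0 e \<Longrightarrow> f (\<tau> w) = w" "\<And>z. z \<in> N \<Longrightarrow> \<tau> (f z) = z"
    using holomorphic_local_inverse[OF f d0] z0 by metis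
  have "br e \<tau>" using e z0 unfolding br_def by metis
  then have eS: "min e \<rho> \<in> S" using br_mono[of e \<tau> "min e \<rho>"] e(1) \<open>\<rho> > 0\<close> by (auto simp: S_def)
  have bdd: "bdd_above S" by (rule bdd_aboveI[of _ \<rho>]) (auto simp: S_def)
  define R where "R = Sup S"
  have "R > 0" using cSup_upper[OF eS bdd] e(1) \<open>\<rho> > 0\<close> by (simp add: R_def min_def split: if_splits)
  have "R \<le> \<rho>" unfolding R_def by (rule cSup_least) (use eS in \<open>auto simp only: S_def\<close>)
  have S_br: "\<exists>\<sigma>. br r \<sigma>" if "r \<in> S" for r using that by (simp add: S_def)
  obtain F where F: "\<And>r. r \<in> S \<Longrightarrow> br r (F r)" using S_br by metis
  have agree1: "F r w = F r' w" if "r \<in> S" "r' \<in> S" "w \<in> ball w0 r" "r \<le> r'" for r r' w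
  proof (rule holomorphic_lift_unique[OF f, of "ball w0 r" "F r" "F r'" w0])
    have b: "br r (F r)" "br r (F r')" using F br_mono that by blast+
    have "r > 0" using that by (simp add: S_def)
    then show "F r holomorphic_on ball w0 r" "F r' holomorphic_on ball w0 r" "F r w0 = F r' w0"
      "deriv f (F r w0) \<noteq> 0" "w0 \<in> ball w0 r"
      using b d0 by (auto simp: br_def)
    show "f (F r w) = f (F r' w)" if "w \<in> ball w0 r" for w using b that by (simp add: br_def)
  qed (use that in auto)
  obtain s where s: "s holomorphic_on (\<Union>r\<in>S. ball w0 r)" "\<And>r w. r \<in> S \<Longrightarrow> w \<in> ball w0 r \<Longrightarrow> s w = F r w"
  proof (rule holomorphic_glue[of S "ball w0" F])
    show "F r holomorphic_on ball w0 r" if "r \<in> S" for r using F[OF that] by (simp add: br_def)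
    show "F r w = F r' w" if "r \<in> S" "r' \<in> S" "w \<in> ball w0 r" "w \<in> ball w0 r'" for r r' w
      using agree1[of r r' w] agree1[of r' r w] that linear[of r r'] by metis
  qed (auto intro: open_ball)
  have Un: "ball w0 R \<subseteq> (\<Union>r\<in>S. ball w0 r)"
  proof
    fix w assume "w \<in> ball w0 R"
    then obtain r where "r \<in> S" "dist w0 w < r" using less_cSup_iff[OF _ bdd] eS unfolding R_def by auto
    then show "w \<in> (\<Union>r\<in>S. ball w0 r)" by auto
  qed
  have "br R s"
    unfolding br_def
  proof (intro conjI ballI)
    show "s holomorphic_on ball w0 R" using s(1) Un holomorphic_on_subset by blast
    show "f (s w) = w" if w: "w \<in> ball w0 R" for w
    proof -
      obtain r where r: "r \<in> S" "w \<in> ball w0 r" using Un w by blast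
      then show ?thesis using s(2)[OF r] F[OF r(1)] by (simp add: br_def)
    qed
    show "s w0 = z0" using s(2)[OF eS, of w0] F[OF eS] e(1) \<open>\<rho> > 0\<close> by (simp add: br_def)
  qed
  have "R = \<rho>"
  proof (rule ccontr)
    assume "R \<noteq> \<rho>"
    then have "R < \<rho>" using \<open>R \<le> \<rho>\<close> by simp
    then have "sphere w0 R \<inter> (critical_values f \<union> asymptotic_values f) = {}"
      using free by (auto simp: disjoint_iff)
    then obtain r' s' where r': "r' > R" "s' holomorphic_on ball w0 r'"
      "\<And>w. w \<in> ball w0 r' \<Longrightarrow> f (s' w) = w" "s' w0 = s w0"
      using inverse_branch_extends[OF f \<open>R > 0\<close>, of s w0] \<open>br R s\<close> unfolding br_def by metis
    then have "br r' s'" using \<open>br R s\<close> by (simp add: br_def)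
    then have "min r' \<rho> \<in> S" using br_mono[of r' s' "min r' \<rho>"] r'(1) \<open>R > 0\<close> \<open>\<rho> > 0\<close> by (auto simp: S_def)
    then have "min r' \<rho> \<le> R" unfolding R_def using bdd cSup_upper by blast
    then show False using r'(1) \<open>R < \<rho>\<close> by linarith
  qed
  then show thesis using that[of s] \<open>br R s\<close> by (simp add: br_def)
qed

subsection \<open>Logarithmic tracts\<close>

text \<open>Inverse branches exist on the disc of radius \<open>norm w - R\<close> about any large
  value \<open>w\<close> that is attained. This makes the set of attained large values open and
  closed in the connected complement of the disc, so it is everything; the images of all branches on
  a small disc are the sheets over it.\<close>

lemma covering_space_large_values:
  fixes f :: "complex \<Rightarrow> complex"
  assumes f: "f holomorphic_on UNIV"
    and sing: "critical_values f \<union> asymptotic_values f \<subseteq> cball 0 R"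
    and z1: "norm (f z1) > R"
  shows "covering_space (f -` (- cball 0 R)) f (- cball 0 R)"
proof -
  define S :: "complex set" where "S = - cball 0 R"
  have "connected S"
    unfolding S_def by (rule connected_complement_bounded_convex) auto
  have contf: "continuous_on A f" for A
    using f holomorphic_on_imp_continuous_on continuous_on_subset by blast
  have disc: "ball w (norm w - R) \<subseteq> S" for w
  proof
    fix x assume "x \<in> ball w (norm w - R)"
    then show "x \<in> S" using norm_triangle_ineq2[of w x] by (simp add: S_def dist_norm)
  qed
  have free: "T \<inter> (critical_values f \<union> asymptotic_values f) = {}" if "T \<subseteq> S" for T
    using that sing by (auto simp: S_def)
  have branch: "\<exists>\<sigma>. \<sigma> holomorphic_on ball w (norm w - R) \<and>
      (\<forall>x\<in>ball w (norm w - R). f (\<sigma> x) = x) \<and> \<sigma> w = z" if "w \<in> S" "f z = w" for w z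
    by (rule inverse_branch_on_ball[OF f _ free[OF disc] that(2)]) (use that in \<open>auto simp: S_def\<close>)
  define I where "I = f ` (f -` S)"
  have mem_I: "w \<in> I" if "w \<in> S" "f z = w" for w z using that by (auto simp: I_def)
  have disc_I: "ball w (norm w - R) \<subseteq> I" if w: "w \<in> I" for w
  proof
    fix x assume x: "x \<in> ball w (norm w - R)"
    obtain z where z: "w \<in> S" "f z = w" using w by (auto simp: I_def)
    then obtain \<sigma> where "f (\<sigma> x) = x" using branch[OF z] x by blast
    then show "x \<in> I" using mem_I disc x by blast
  qed
  have IS: "I \<subseteq> S" by (auto simp: I_def)
  have pos: "norm w - R > 0" if "w \<in> S" for w using that by (simp add: S_def)
  have "open I"
    unfolding open_contains_ball using disc_I IS pos by blast
  have "open (S - I)"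
    unfolding open_contains_ball
  proof
    fix w assume w: "w \<in> S - I"
    \<comment> \<open>With half the distance to the disc, any \<open>x\<close> in
      \<open>ball w d\<close> satisfies \<open>norm x - R > d\<close>, so the disc belonging to
      \<open>x\<close> contains \<open>w\<close>; an attained \<open>x\<close> would force
      \<open>w\<close> to be attained.\<close>
    define d where "d = (norm w - R) / 2"
    have "d > 0" using w pos by (simp add: d_def)
    moreover have "ball w d \<subseteq> S - I"
    proof
      fix x assume x: "x \<in> ball w d"
      then have d1: "dist w x < d" by simp
      then have "x \<in> S" using disc[of w] \<open>d > 0\<close> by (auto simp: d_def)
      moreover have "x \<notin> I"
      proof
        assume "x \<in> I"
        have "norm w - norm x < d" using d1 norm_triangle_ineq2[of w x] by (simp add: dist_norm)
        then have "dist x w < norm x - R" using d1 by (simp add: d_def dist_commute field_simps)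
        then have "w \<in> I" using disc_I[OF \<open>x \<in> I\<close>] by auto
        then show False using w by blast
      qed
      ultimately show "x \<in> S - I" by blast
    qed
    ultimately show "\<exists>e>0. ball w e \<subseteq> S - I" by blast
  qed
  have "f z1 \<in> I" using z1 by (auto simp: I_def S_def)
  then have "S - I = {}"
    using connectedD[OF \<open>connected S\<close> \<open>open I\<close> \<open>open (S - I)\<close>] IS by blast
  then have onto: "f ` (f -` S) = S" using IS unfolding I_def by blast
  have "covering_space (f -` S) f S"
  proof (rule covering_spaceI[OF contf onto])
    fix w assume w: "w \<in> S"
    \<comment> \<open>With a quarter of the distance, whenever \<open>f z\<close> lies in
      \<open>T\<close> the branch taking \<open>f z\<close> to \<open>z\<close> is defined on a disc
      of radius greater than \<open>2 * d\<close>, which contains all of \<open>T\<close>. Thus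
      every point over \<open>T\<close> lies on a sheet given by a branch on the whole of
      \<open>T\<close>.\<close>
    define d where "d = (norm w - R) / 4"
    define T where "T = ball w d"
    have "d > 0" using pos[OF w] by (simp add: d_def)
    then have T: "w \<in> T" "open T" "connected T" "T \<subseteq> S"
      using subset_ball[of d "norm w - R" w] disc[of w] by (auto simp: T_def d_def)
    define B where "B = {\<sigma>. \<sigma> holomorphic_on T \<and> (\<forall>x\<in>T. f (\<sigma> x) = x)}"
    define v where "v = (\<lambda>\<sigma>. \<sigma> ` T) ` B"
    have crit: "deriv f z \<noteq> 0" if "f z \<in> S" for z
      using free[of S] that unfolding critical_values_def by blast
    have Bh: "\<sigma> holomorphic_on T" and Bf: "x \<in> T \<Longrightarrow> f (\<sigma> x) = x" if "\<sigma> \<in> B" for \<sigma> x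
      using that by (auto simp: B_def)
    have v1: "\<Union>v = f -` S \<inter> f -` T"
    proof (intro equalityI subsetI)
      fix z assume "z \<in> \<Union>v"
      then show "z \<in> f -` S \<inter> f -` T" using T(4) Bf by (fastforce simp: v_def)
    next
      fix z assume z: "z \<in> f -` S \<inter> f -` T"
      then have dz: "dist w (f z) < d" by (simp add: T_def)
      then have "norm w - norm (f z) < d" using norm_triangle_ineq2[of w "f z"] by (simp add: dist_norm)
      then have "2 * d < norm (f z) - R" using \<open>d > 0\<close> by (simp add: d_def field_simps)
      have TT: "T \<subseteq> ball (f z) (norm (f z) - R)"
      proof
        fix x assume "x \<in> T"
        then have "dist (f z) x < 2 * d"
          using dz dist_triangle[of "f z" x w] by (simp add: T_def dist_commute)
        then show "x \<in> ball (f z) (norm (f z) - R)" using \<open>2 * d < norm (f z) - R\<close> by simp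
      qed
      have "f z \<in> S" using z by simp
      then obtain \<sigma> where \<sigma>: "\<sigma> holomorphic_on ball (f z) (norm (f z) - R)"
        "\<forall>x\<in>ball (f z) (norm (f z) - R). f (\<sigma> x) = x" "\<sigma> (f z) = z"
        using branch[OF \<open>f z \<in> S\<close> refl] by blast
      have "\<sigma> \<in> B" unfolding B_def using \<sigma>(1,2) TT holomorphic_on_subset by blast
      moreover have "z \<in> \<sigma> ` T" using z \<sigma>(3) by (metis IntD2 imageI vimageD)
      ultimately show "z \<in> \<Union>v" unfolding v_def by blast
    qed
    have v2: "open u" if "u \<in> v" for u
    proof -
      obtain \<sigma> where \<sigma>: "\<sigma> \<in> B" "u = \<sigma> ` T" using \<open>u \<in> v\<close> by (auto simp: v_def)
      have "inj_on \<sigma> T" by (rule inj_on_inverseI[of _ f]) (use Bf \<sigma> in auto)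
      then show ?thesis using open_mapping_thm3 Bh \<sigma> T(2) by blast
    qed
    have v3: "pairwise disjnt v"
    proof (rule pairwiseI)
      fix u u' assume u: "u \<in> v" "u' \<in> v" "u \<noteq> u'"
      obtain \<sigma> where \<sigma>: "\<sigma> \<in> B" "u = \<sigma> ` T" using \<open>u \<in> v\<close> by (auto simp: v_def)
      obtain \<tau> where \<tau>: "\<tau> \<in> B" "u' = \<tau> ` T" using \<open>u' \<in> v\<close> by (auto simp: v_def)
      show "disjnt u u'"
      proof (rule ccontr)
        assume "\<not> disjnt u u'"
        then obtain x y where xy: "x \<in> T" "y \<in> T" "\<sigma> x = \<tau> y" using \<sigma> \<tau> by (auto simp: disjnt_iff)
        then have "x = y" using Bf \<sigma>(1) \<tau>(1) by metis
        have "\<sigma> t = \<tau> t" if "t \<in> T" for t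
          by (rule holomorphic_lift_unique[OF f T(2,3), of \<sigma> \<tau> x])
            (use Bh Bf \<sigma> \<tau> xy \<open>x = y\<close> that crit T(4) in auto)
        then have "u = u'" using \<sigma>(2) \<tau>(2) by auto
        then show False using u(3) by blast
      qed
    qed
    have v4: "\<exists>q. homeomorphism u T f q" if "u \<in> v" for u
    proof -
      obtain \<sigma> where \<sigma>: "\<sigma> \<in> B" "u = \<sigma> ` T" using \<open>u \<in> v\<close> by (auto simp: v_def)
      have "homeomorphism u T f \<sigma>"
        unfolding homeomorphism_def using \<sigma> Bf[OF \<sigma>(1)] contf Bh holomorphic_on_imp_continuous_on
        by (auto simp: image_iff)
      then show ?thesis by blast
    qed
    have "openin (top_of_set S) T" using T by (simp add: open_subset)
    moreover have "openin (top_of_set (f -` S)) u" if "u \<in> v" for u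
      by (rule open_subset[OF _ v2[OF that]]) (use v1 that in blast)
    ultimately show "\<exists>T. w \<in> T \<and> openin (top_of_set S) T \<and>
          (\<exists>v. \<Union> v = f -` S \<inter> f -` T \<and> (\<forall>u\<in>v. openin (top_of_set (f -` S)) u) \<and> pairwise disjnt v \<and>
            (\<forall>u\<in>v. \<exists>q. homeomorphism u T f q))"
      using T(1) v1 v3 v4 by (intro exI[of _ T] conjI exI[of _ v]) auto
  qed
  then show ?thesis by (simp add: S_def)
qed

section \<open>Holomorphic lifts of the exponential through an entire function\<close>

text \<open>Locally \<open>\<psi>\<close> is a holomorphic inverse branch of \<open>f\<close>
  composed with \<open>h\<close>; continuity keeps \<open>\<psi>\<close> in the neighbourhood where
  that branch inverts \<open>f\<close>.\<close>

lemma continuous_lift_holomorphic: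
  fixes f :: "complex \<Rightarrow> complex"
  assumes f: "f holomorphic_on UNIV" and U: "open U" and \<psi>: "continuous_on U \<psi>"
    and h: "h holomorphic_on U" "\<And>z. z \<in> U \<Longrightarrow> f (\<psi> z) = h z"
    and nz: "\<And>z. z \<in> U \<Longrightarrow> deriv f (\<psi> z) \<noteq> 0"
  shows "\<psi> holomorphic_on U"
  unfolding holomorphic_on_open[OF U]
proof
  fix z assume z: "z \<in> U"
  obtain e \<tau> N where N: "e > 0" "open N" "\<psi> z \<in> N" "\<tau> holomorphic_on ball (h z) e"
    "\<And>z. z \<in> N \<Longrightarrow> \<tau> (f z) = z"
    using holomorphic_local_inverse[OF f nz[OF z]] h(2)[OF z] by metis
  define V where "V = (U \<inter> \<psi> -` N) \<inter> (U \<inter> h -` ball (h z) e)"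
  have "open V" unfolding V_def
    using h(1) \<psi> U N holomorphic_on_imp_continuous_on
    by (intro open_Int continuous_open_preimage) auto
  have "z \<in> V" using z N by (simp add: V_def)
  have "(\<tau> \<circ> h) holomorphic_on V"
    by (rule holomorphic_on_compose_gen[OF holomorphic_on_subset[OF h(1)] N(4)]) (auto simp: V_def)
  moreover have "(\<tau> \<circ> h) x = \<psi> x" if "x \<in> V" for x
    using that N(5)[of "\<psi> x"] h(2)[of x] by (simp add: V_def)
  ultimately have "\<psi> holomorphic_on V" by (rule holomorphic_transform)
  then show "\<exists>f'. (\<psi> has_field_derivative f') (at z)"
    using \<open>open V\<close> \<open>z \<in> V\<close> holomorphic_derivI by blast
qed

text \<open>An entire function with a pole at infinity is a polynomial.\<close>

lemma transcendental_not_tendsto_infinity: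
  assumes "transcendental_entire f"
  shows "\<not> filterlim f at_infinity at_infinity"
proof
  assume "filterlim f at_infinity at_infinity"
  then have "((inverse \<circ> f) \<longlongrightarrow> 0) at_infinity"
    unfolding comp_def by (rule filterlim_compose[OF tendsto_inverse_0])
  then obtain a n where "\<And>z. f z = (\<Sum>i\<le>n. a i * z ^ i)"
    using pole_at_infinity[of f 0] assms unfolding transcendental_entire_def entire_def by blast
  then have "\<And>z. f z = poly (\<Sum>i\<le>n. monom (a i) i) z"
    by (simp add: poly_sum poly_monom)
  then show False using assms unfolding transcendental_entire_def by blast
qed

lemma norm_exp_gt_iff:
  fixes \<omega> :: complex
  assumes "R > 0"
  shows "norm (exp \<omega>) > R \<longleftrightarrow> Re \<omega> > ln R"
  by (metis assms exp_gt_zero ln_exp ln_less_cancel_iff norm_exp_eq_Re)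

text \<open>The exponential maps the simply connected half-plane into the complement of the disc,
  over which \<open>f\<close> is a covering; the lift starting at the prescribed preimage
  \<open>z1\<close> is holomorphic since no critical value is met.\<close>

lemma exp_lift:
  fixes f :: "complex \<Rightarrow> complex"
  assumes f: "f holomorphic_on UNIV" and "R > 0"
    and sing: "critical_values f \<union> asymptotic_values f \<subseteq> cball 0 R"
    and z1: "norm (f z1) > R" "exp \<omega>1 = f z1"
  obtains \<psi> where "\<psi> holomorphic_on {\<omega>. Re \<omega> > ln R}" "\<psi> \<omega>1 = z1"
    "\<And>\<omega>. Re \<omega> > ln R \<Longrightarrow> f (\<psi> \<omega>) = exp \<omega>"
proof -
  define H where "H = {\<omega>. Re \<omega> > ln R}"
  have big: "norm (exp \<omega>) > R" if "\<omega> \<in> H" for \<omega>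
    using that norm_exp_gt_iff[OF \<open>R > 0\<close>] by (simp add: H_def del: norm_exp_eq_Re)
  have "\<omega>1 \<in> H" using norm_exp_gt_iff[OF \<open>R > 0\<close>, of \<omega>1] z1 by (simp add: H_def)
  have "open H" "convex H"
    using open_halfspace_Re_gt[of "ln R"] convex_halfspace_Re_gt[of "ln R"] by (auto simp: H_def)
  obtain \<psi> where \<psi>: "continuous_on H \<psi>" "\<psi> \<omega>1 = z1" "\<And>\<omega>. \<omega> \<in> H \<Longrightarrow> f (\<psi> \<omega>) = exp \<omega>"
  proof (rule covering_space_lift_strong[OF covering_space_large_values[OF f sing z1(1)], of z1 \<omega>1 H exp])
    show "simply_connected H" using \<open>convex H\<close> by (rule convex_imp_simply_connected)
    show "locally path_connected H" using \<open>open H\<close> by (rule open_imp_locally_path_connected)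
    show "continuous_on H exp" by (intro continuous_intros)
  qed (use big z1 \<open>\<omega>1 \<in> H\<close> in \<open>auto simp: not_le\<close>)
  have "\<psi> holomorphic_on H"
  proof (rule continuous_lift_holomorphic[OF f \<open>open H\<close> \<psi>(1) _ \<psi>(3)])
    show "exp holomorphic_on H" by (intro holomorphic_intros)
    show "deriv f (\<psi> \<omega>) \<noteq> 0" if "\<omega> \<in> H" for \<omega>
    proof
      assume "deriv f (\<psi> \<omega>) = 0"
      then have "exp \<omega> \<in> cball 0 R"
        using sing \<psi>(3)[OF that] unfolding critical_values_def by force
      then show False using big[OF that] by simp
    qed
  qed
  then show thesis using that \<psi> by (auto simp: H_def)
qed

text \<open>Periodicity makes the image of the line \<open>Re \<omega> = x\<close> compact, so it
  lies in some disc. Outside that disc the image of the half-plane to the right of the line is both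
  open and relatively closed, hence contains all points of large modulus; there
  \<open>norm (f z)\<close> exceeds \<open>exp x\<close>.\<close>

lemma periodic_exp_lift_tendsto_infinity:
  fixes f :: "complex \<Rightarrow> complex"
  assumes f: "f holomorphic_on UNIV"
    and \<psi>: "\<psi> holomorphic_on {\<omega>. Re \<omega> > a}"
    and f\<psi>: "\<And>\<omega>. Re \<omega> > a \<Longrightarrow> f (\<psi> \<omega>) = exp \<omega>"
    and "P > 0" and per: "\<And>\<omega>. Re \<omega> > a \<Longrightarrow> \<psi> (\<omega> + \<i> * of_real P) = \<psi> \<omega>"
  shows "filterlim f at_infinity at_infinity"
proof -
  define H where "H = {\<omega>. Re \<omega> > a}"
  have H: "open H" "convex H"
    using open_halfspace_Re_gt[of a] convex_halfspace_Re_gt[of a] by (auto simp: H_def)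
  have cont: "continuous_on A \<psi>" if "A \<subseteq> H" for A
    using \<psi> that holomorphic_on_imp_continuous_on holomorphic_on_subset unfolding H_def by metis
  have per_nat: "\<psi> (\<omega> + of_nat n * (\<i> * of_real P)) = \<psi> \<omega>" if "Re \<omega> > a" for \<omega> n
  proof (induction n)
    case (Suc n)
    have "\<psi> (\<omega> + of_nat (Suc n) * (\<i> * of_real P)) = \<psi> ((\<omega> + of_nat n * (\<i> * of_real P)) + \<i> * of_real P)"
      by (simp add: algebra_simps)
    also have "\<dots> = \<psi> (\<omega> + of_nat n * (\<i> * of_real P))" by (rule per) (use that in simp)
    finally show ?case using Suc by simp
  qed simp
  have per_int: "\<psi> (\<omega> + of_int k * (\<i> * of_real P)) = \<psi> \<omega>" if "Re \<omega> > a" for \<omega> k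
  proof (cases "k \<ge> 0")
    case True
    then show ?thesis using per_nat[OF that, of "nat k"] by simp
  next
    case False
    then show ?thesis
      using per_nat[of "\<omega> + of_int k * (\<i> * of_real P)" "nat (- k)"] that by (simp add: algebra_simps)
  qed
  have reduce: "\<exists>\<omega>'. Re \<omega>' = Re \<omega> \<and> Im \<omega>' \<in> {0..P} \<and> \<psi> \<omega>' = \<psi> \<omega>" if "Re \<omega> > a" for \<omega>
  proof (intro exI conjI)
    let ?k = "\<lfloor>Im \<omega> / P\<rfloor>"
    have "of_int ?k * P \<le> Im \<omega>"
      by (rule pos_le_divide_eq[OF \<open>P > 0\<close>, THEN iffD1, OF of_int_floor_le])
    moreover have "Im \<omega> \<le> (of_int ?k + 1) * P"
      by (rule pos_divide_le_eq[OF \<open>P > 0\<close>, THEN iffD1, OF real_of_int_floor_add_one_ge])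
    ultimately show "Im (\<omega> + of_int (- ?k) * (\<i> * of_real P)) \<in> {0..P}" by (simp add: algebra_simps)
    show "\<psi> (\<omega> + of_int (- ?k) * (\<i> * of_real P)) = \<psi> \<omega>" using per_int that by blast
  qed simp
  define box where "box x y = cbox (Complex x 0) (Complex y P)" for x y
  have mem_box: "\<omega> \<in> box x y \<longleftrightarrow> x \<le> Re \<omega> \<and> Re \<omega> \<le> y \<and> 0 \<le> Im \<omega> \<and> Im \<omega> \<le> P" for \<omega> x y
    by (auto simp: box_def in_cbox_complex_iff)
  have cbox: "compact (\<psi> ` box x y)" if "x > a" for x y
  proof (rule compact_continuous_image)
    show "continuous_on (box x y) \<psi>" using that by (intro cont) (auto simp: mem_box H_def)
  qed (simp add: box_def)
  have "\<not> \<psi> constant_on H"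
  proof
    assume "\<psi> constant_on H"
    then obtain c where "\<And>\<omega>. \<omega> \<in> H \<Longrightarrow> \<psi> \<omega> = c" unfolding constant_on_def by blast
    then have "exp (of_real (a + 1)) = f c" "exp (of_real (a + 2)) = f c"
      using f\<psi>[of "of_real (a + 1)"] f\<psi>[of "of_real (a + 2)"] by (simp_all add: H_def)
    then have "exp (of_real (a + 1) :: complex) = exp (of_real (a + 2))" by simp
    then have "norm (exp (of_real (a + 1) :: complex)) = norm (exp (of_real (a + 2) :: complex))" by (rule arg_cong)
    then show False by (simp only: norm_exp_eq_Re Re_complex_of_real exp_inj_iff)
  qed
  \<comment> \<open>Where \<open>\<psi>\<close> is bounded, so is
    \<open>f \<circ> \<psi> = exp\<close>, and therefore the real part of the argument is bounded
    above.\<close>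
  have large: "\<exists>B. \<forall>\<omega>. Re \<omega> > a \<longrightarrow> norm (\<psi> \<omega>) \<le> M \<longrightarrow> Re \<omega> \<le> B" for M
  proof -
    have "bounded (f ` cball 0 M)"
      by (intro compact_imp_bounded compact_continuous_image compact_cball
          continuous_on_subset[OF holomorphic_on_imp_continuous_on[OF f] subset_UNIV])
    then obtain B where B: "B > 0" "\<And>z. z \<in> cball 0 M \<Longrightarrow> norm (f z) \<le> B"
      by (auto simp: bounded_pos)
    have "Re \<omega> \<le> ln B" if "Re \<omega> > a" "norm (\<psi> \<omega>) \<le> M" for \<omega>
      using B(2)[of "\<psi> \<omega>"] that f\<psi>[of \<omega>] B(1) by (simp add: ln_ge_iff)
    then show ?thesis by blast
  qed
  have "\<exists>M. \<forall>z. norm z > M \<longrightarrow> norm (f z) > exp x" if "x > a" for x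
  proof -
    have "bounded (\<psi> ` box x x)" using cbox[OF that] compact_imp_bounded by blast
    then obtain M where M0: "\<And>\<omega>. \<omega> \<in> box x x \<Longrightarrow> norm (\<psi> \<omega>) \<le> M" by (auto simp: bounded_pos)
    have M: "norm (\<psi> \<omega>) \<le> M" if "Re \<omega> = x" for \<omega>
    proof -
      obtain \<omega>' where "Re \<omega>' = Re \<omega>" "Im \<omega>' \<in> {0..P}" "\<psi> \<omega>' = \<psi> \<omega>"
        using reduce[of \<omega>] \<open>Re \<omega> = x\<close> \<open>x > a\<close> by auto
      then show ?thesis using M0[of \<omega>'] \<open>Re \<omega> = x\<close> by (simp add: mem_box)
    qed
    define O' where "O' = \<psi> ` {\<omega>. Re \<omega> > x}"
    define Q where "Q = \<psi> ` {\<omega>. Re \<omega> \<ge> x}"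
    have "open O'"
      unfolding O'_def using that \<open>\<not> \<psi> constant_on H\<close> H \<psi> convex_connected open_halfspace_Re_gt
      by (intro open_mapping_thm[of \<psi> H]) (auto simp: H_def)
    \<comment> \<open>A convergent sequence in \<open>Q\<close> is bounded, so its preimages have
      bounded real part by \<open>large\<close>; after reduction by the period they lie in one
      compact box.\<close>
    have "closed Q"
      unfolding closed_sequential_limits
    proof (intro allI impI)
      fix y l assume "(\<forall>n. y n \<in> Q) \<and> y \<longlonglongrightarrow> l"
      then have y: "\<And>n. y n \<in> Q" "y \<longlonglongrightarrow> l" by auto
      obtain K where K: "\<And>n. norm (y n) \<le> K"
        using convergent_imp_bounded[OF y(2)] by (auto simp: bounded_iff)
      obtain B where B: "\<And>\<omega>. Re \<omega> > a \<Longrightarrow> norm (\<psi> \<omega>) \<le> K \<Longrightarrow> Re \<omega> \<le> B" using large by blast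
      have "y n \<in> \<psi> ` box x B" for n
      proof -
        obtain \<omega> where "Re \<omega> \<ge> x" "y n = \<psi> \<omega>" using y(1)[of n] by (auto simp: Q_def)
        moreover obtain \<omega>' where "Re \<omega>' = Re \<omega>" "Im \<omega>' \<in> {0..P}" "\<psi> \<omega>' = \<psi> \<omega>"
          using reduce[of \<omega>] calculation \<open>x > a\<close> by auto
        moreover have "Re \<omega> \<le> B" using B[of \<omega>] calculation that K[of n] by auto
        ultimately have "\<omega>' \<in> box x B" "y n = \<psi> \<omega>'" by (auto simp: mem_box)
        then show ?thesis by blast
      qed
      then have "l \<in> \<psi> ` box x B"
        using closed_sequentially[OF compact_imp_closed[OF cbox[OF that]] _ y(2)] by blast
      then show "l \<in> Q" by (auto simp: Q_def mem_box)
    qed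
    define W :: "complex set" where "W = - cball 0 M"
    have "connected W" unfolding W_def by (rule connected_complement_bounded_convex) auto
    have WQ: "W \<inter> Q \<subseteq> O'"
    proof
      fix z assume z: "z \<in> W \<inter> Q"
      then obtain \<omega> where \<omega>: "Re \<omega> \<ge> x" "z = \<psi> \<omega>" by (auto simp: Q_def)
      have "Re \<omega> \<noteq> x" using M[of \<omega>] z \<omega>(2) by (auto simp: W_def)
      then show "z \<in> O'" using \<omega> by (auto simp: O'_def)
    qed
    obtain B where B: "\<And>\<omega>. Re \<omega> > a \<Longrightarrow> norm (\<psi> \<omega>) \<le> M \<Longrightarrow> Re \<omega> \<le> B" using large by blast
    \<comment> \<open>The real part exceeds the bound \<open>B\<close>, so
      \<open>\<psi> \<omega>\<close> leaves the disc of radius \<open>M\<close>. This shows that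
      \<open>W\<close> meets \<open>O'\<close>, and connectedness of \<open>W\<close> excludes the
      complement of \<open>Q\<close>.\<close>
    define \<omega> where "\<omega> = complex_of_real (max x B + 1)"
    have "\<psi> \<omega> \<in> W \<inter> O'"
      using B[of \<omega>] that by (force simp: \<omega>_def W_def O'_def)
    moreover have "O' \<subseteq> Q" by (auto simp: O'_def Q_def)
    ultimately have "W \<inter> - Q = {}"
      using connectedD[OF \<open>connected W\<close> \<open>open O'\<close> open_Compl[OF \<open>closed Q\<close>]] WQ by blast
    then have W: "W \<subseteq> O'" using WQ by blast
    have "norm (f z) > exp x" if "norm z > M" for z
    proof -
      have "z \<in> O'" using W that by (auto simp: W_def)
      then obtain \<omega> where "Re \<omega> > x" "z = \<psi> \<omega>" by (auto simp: O'_def)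
      then show ?thesis using f\<psi>[of \<omega>] \<open>x > a\<close> by simp
    qed
    then show ?thesis by blast
  qed note grow = this
  show ?thesis
    unfolding filterlim_at_infinity[OF order_refl] eventually_at_infinity
  proof (intro allI impI)
    fix r :: real assume "r > 0"
    define x where "x = max (a + 1) (ln r)"
    have "x > a" by (simp add: x_def)
    have "exp x \<ge> r" using \<open>r > 0\<close> by (metis exp_le_cancel_iff exp_ln max.cobounded2 x_def)
    obtain M where "\<And>z. norm z > M \<Longrightarrow> norm (f z) > exp x" using grow[OF \<open>x > a\<close>] by blast
    then show "\<exists>b. \<forall>z. b \<le> norm z \<longrightarrow> r \<le> norm (f z)"
      using \<open>exp x \<ge> r\<close> by (intro exI[of _ "M + 1"]) (smt (verit))
  qed
qed

text \<open>If \<open>\<psi> v = \<psi> w\<close> then \<open>exp v = exp w\<close>, so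
  \<open>w\<close> is a vertical translate of \<open>v\<close>. The translate of
  \<open>\<psi>\<close> by that amount is again a lift of \<open>exp\<close> and agrees with
  \<open>\<psi>\<close> at \<open>v\<close>; hence \<open>\<psi>\<close> would be periodic and
  \<open>f\<close> would tend to infinity, which a transcendental function does not.\<close>

lemma exp_lift_injective:
  assumes f: "transcendental_entire f"
    and crit: "\<And>\<omega>. Re \<omega> > a \<Longrightarrow> deriv f (\<psi> \<omega>) \<noteq> 0"
    and \<psi>: "\<psi> holomorphic_on {\<omega>. Re \<omega> > a}"
    and f\<psi>: "\<And>\<omega>. Re \<omega> > a \<Longrightarrow> f (\<psi> \<omega>) = exp \<omega>"
  shows "inj_on \<psi> {\<omega>. Re \<omega> > a}"
proof -
  have hol: "f holomorphic_on UNIV" using f by (simp add: transcendental_entire_def entire_def)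
  have H: "open {\<omega>. Re \<omega> > a}" "connected {\<omega>. Re \<omega> > a}"
    using open_halfspace_Re_gt[of a] convex_halfspace_Re_gt[of a] convex_connected by auto
  have False if v: "Re v > a" "Re w > a" "\<psi> v = \<psi> w" "Im v < Im w" for v w
  proof -
    have e: "exp v = exp w" using f\<psi> v by metis
    define P where "P = Im w - Im v"
    have "exp (Re v) = exp (Re w)" using e norm_exp_eq_Re by metis
    then have w: "w = v + \<i> * of_real P" by (simp add: P_def complex_eq_iff)
    have "exp (v + \<i> * of_real P) = exp v" using e w by simp
    then have e1: "exp (\<i> * of_real P) = 1" by (simp add: exp_add)
    have per: "\<psi> \<omega> = \<psi> (\<omega> + \<i> * of_real P)" if "Re \<omega> > a" for \<omega>
    proof (rule holomorphic_lift_unique[OF hol H \<psi>, of "\<lambda>\<omega>. \<psi> (\<omega> + \<i> * of_real P)" v])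
      have "\<psi> \<circ> (\<lambda>\<omega>. \<omega> + \<i> * of_real P) holomorphic_on {\<omega>. Re \<omega> > a}"
        by (rule holomorphic_on_compose_gen[OF _ \<psi>]) (auto intro!: holomorphic_intros)
      then show "(\<lambda>\<omega>. \<psi> (\<omega> + \<i> * of_real P)) holomorphic_on {\<omega>. Re \<omega> > a}" by (simp add: o_def)
    qed (use that v w crit f\<psi> e1 in \<open>auto simp: exp_add\<close>)
    have "filterlim f at_infinity at_infinity"
      by (rule periodic_exp_lift_tendsto_infinity[OF hol \<psi> f\<psi>, of P])
        (use v per[symmetric] in \<open>simp_all add: P_def\<close>)
    then show False using transcendental_not_tendsto_infinity[OF f] by blast
  qed note no = this
  show ?thesis
  proof (rule inj_onI)
    fix v w assume v: "v \<in> {\<omega>. Re \<omega> > a}" "w \<in> {\<omega>. Re \<omega> > a}" "\<psi> v = \<psi> w"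
    then have "exp v = exp w" using f\<psi> by (metis mem_Collect_eq)
    then have "Re v = Re w" using norm_exp_eq_Re by (metis exp_inj_iff)
    moreover have "Im v = Im w" using no[of v w] no[of w v] v by (metis linorder_less_linear mem_Collect_eq)
    ultimately show "v = w" by (simp add: complex_eq_iff)
  qed
qed

text \<open>\<open>\<Phi>\<close> is a logarithm of the injective lift \<open>\<psi>\<close>, which
  avoids 0 because \<open>norm (f 0) \<le> R\<close>. By injectivity the image of
  \<open>\<Phi>\<close> contains no two points differing by \<open>2 * pi * \<i>\<close>, hence no
  disc of radius greater than \<open>pi\<close>; Bloch's theorem with constant 1/12 on the disc of
  radius \<open>Re \<omega> - ln R\<close> bounds the derivative.\<close>

lemma logarithmic_tract:
  assumes f: "transcendental_entire f"
    and sing: "critical_values f \<union> asymptotic_values f \<subseteq> cball 0 R" and R: "norm (f 0) \<le> R" "R > 0"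
    and z1: "norm (f z1) > R" "exp \<omega>1 = f z1"
  obtains \<Phi> where "\<Phi> holomorphic_on {\<omega>. Re \<omega> > ln R}" "exp (\<Phi> \<omega>1) = z1"
    "\<And>\<omega>. Re \<omega> > ln R \<Longrightarrow> f (exp (\<Phi> \<omega>)) = exp \<omega>"
    "\<And>\<omega>. Re \<omega> > ln R \<Longrightarrow> norm (deriv \<Phi> \<omega>) * (Re \<omega> - ln R) \<le> 12 * pi"
proof -
  define H where "H = {\<omega>. Re \<omega> > ln R}"
  have hol: "f holomorphic_on UNIV" using f by (simp add: transcendental_entire_def entire_def)
  have H: "open H" "convex H"
    using open_halfspace_Re_gt[of "ln R"] convex_halfspace_Re_gt[of "ln R"] by (auto simp: H_def)
  obtain \<psi> where \<psi>: "\<psi> holomorphic_on H" "\<psi> \<omega>1 = z1" "\<And>\<omega>. \<omega> \<in> H \<Longrightarrow> f (\<psi> \<omega>) = exp \<omega>"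
    by (rule exp_lift[OF hol R(2) sing z1]) (simp add: H_def)
  have big: "norm (exp \<omega>) > R" if "\<omega> \<in> H" for \<omega>
    using that norm_exp_gt_iff[OF \<open>R > 0\<close>] by (simp add: H_def del: norm_exp_eq_Re)
  have "\<omega>1 \<in> H" using norm_exp_gt_iff[OF \<open>R > 0\<close>, of \<omega>1] z1 by (simp add: H_def)
  have crit: "deriv f (\<psi> \<omega>) \<noteq> 0" if "\<omega> \<in> H" for \<omega>
  proof
    assume "deriv f (\<psi> \<omega>) = 0"
    then have "exp \<omega> \<in> cball 0 R"
      using sing \<psi>(3)[OF that] unfolding critical_values_def by force
    then show False using big[OF that] by simp
  qed
  have inj: "inj_on \<psi> H"
    using exp_lift_injective[OF f, of "ln R" \<psi>] crit \<psi> unfolding H_def by blast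
  have "\<psi> \<omega> \<noteq> 0" if "\<omega> \<in> H" for \<omega>
    using \<psi>(3)[OF that] big[OF that] R(1) by (metis not_le)
  then obtain \<Phi> where \<Phi>: "\<Phi> holomorphic_on H" "\<And>\<omega>. \<omega> \<in> H \<Longrightarrow> \<psi> \<omega> = exp (\<Phi> \<omega>)"
    using contractible_imp_holomorphic_log[OF \<psi>(1) convex_imp_contractible[OF H(2)]] by metis
  show thesis
  proof (rule that[of \<Phi>])
    fix \<omega> assume \<omega>: "Re \<omega> > ln R"
    then show "f (exp (\<Phi> \<omega>)) = exp \<omega>" using \<psi>(3)[of \<omega>] \<Phi>(2)[of \<omega>] by (simp add: H_def)
    define r where "r = Re \<omega> - ln R"
    have sub: "ball \<omega> r \<subseteq> H"
    proof
      fix x assume "x \<in> ball \<omega> r"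
      then have "\<bar>Re (\<omega> - x)\<bar> < r" using abs_Re_le_cmod[of "\<omega> - x"] by (simp add: dist_norm)
      then show "x \<in> H" by (simp add: H_def r_def)
    qed
    show "norm (deriv \<Phi> \<omega>) * (Re \<omega> - ln R) \<le> 12 * pi"
    proof (rule ccontr)
      assume "\<not> ?thesis"
      then have big': "r * norm (deriv \<Phi> \<omega>) / 12 > pi" by (simp add: r_def mult.commute)
      obtain b where b: "ball b (r * norm (deriv \<Phi> \<omega>) / 12) \<subseteq> \<Phi> ` ball \<omega> r"
        using Bloch[OF holomorphic_on_subset[OF \<Phi>(1) sub] _ order_refl] \<omega> by (auto simp: r_def)
      have "b + \<i> * of_real pi \<in> ball b (r * norm (deriv \<Phi> \<omega>) / 12)"
        "b - \<i> * of_real pi \<in> ball b (r * norm (deriv \<Phi> \<omega>) / 12)"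
        using big' by (simp_all add: dist_norm norm_mult)
      then obtain v w where v: "v \<in> H" "w \<in> H" "\<Phi> v = b + \<i> * of_real pi" "\<Phi> w = b - \<i> * of_real pi"
        using b sub by (smt (verit, del_insts) imageE subsetD)
      have "\<Phi> v = \<Phi> w + 2 * of_real pi * \<i>" using v by simp
      then have "exp (\<Phi> v) = exp (\<Phi> w) * exp (2 * of_real pi * \<i>)" by (simp only: exp_add)
      then have "\<psi> v = \<psi> w" using \<Phi>(2)[OF v(1)] \<Phi>(2)[OF v(2)] by (simp only: exp_two_pi_i mult_1_right)
      then have "v = w" using inj v by (simp add: inj_on_def)
      then show False using v by simp
    qed
  qed (use \<Phi> \<psi> \<open>\<omega>1 \<in> H\<close> in \<open>auto simp: H_def\<close>)
qed

subsection \<open>Maps into a half-plane and maps omitting two values\<close>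

text \<open>The function \<open>c\<close> is \<open>L\<close>, rescaled to the unit disc and
  followed by the Moebius map of the right half-plane onto the unit disc taking \<open>L z0\<close>
  to 0. The Schwarz lemma at \<open>norm u \<le> 1 / 5\<close> gives
  \<open>5 * t \<le> t + 2 * Re (L z0)\<close> for \<open>t = norm (L z - L z0)\<close>; the radius
  \<open>r / 5\<close> is chosen to give the factor 1/2.\<close>

lemma half_plane_Harnack:
  assumes "r > 0" and L: "L holomorphic_on ball z0 r"
    and pos: "\<And>z. z \<in> ball z0 r \<Longrightarrow> Re (L z) > 0"
    and z: "norm (z - z0) \<le> r / 5"
  shows "norm (L z - L z0) \<le> Re (L z0) / 2"
proof -
  define c where "c u = (L (z0 + of_real r * u) - L z0) / (L (z0 + of_real r * u) + cnj (L z0))" for u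
  have in_ball: "z0 + of_real r * u \<in> ball z0 r" if "norm u < 1" for u
    using that \<open>r > 0\<close> by (simp add: dist_norm norm_mult)
  have p0: "Re (L z0) > 0" using pos[of z0] \<open>r > 0\<close> by simp
  have lt: "norm (w - L z0) < norm (w + cnj (L z0))" and nz: "w + cnj (L z0) \<noteq> 0" if "Re w > 0" for w
  proof -
    have "(norm (w + cnj (L z0)))\<^sup>2 - (norm (w - L z0))\<^sup>2 = 4 * (Re w * Re (L z0))"
      unfolding cmod_power2 by (simp add: power2_eq_square algebra_simps)
    moreover have "Re w * Re (L z0) > 0" using that p0 by simp
    ultimately have "(norm (w - L z0))\<^sup>2 < (norm (w + cnj (L z0)))\<^sup>2" by linarith
    then show "norm (w - L z0) < norm (w + cnj (L z0))" by (simp add: power_less_imp_less_base)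
    have "Re (w + cnj (L z0)) > 0" using that p0 by simp
    then show "w + cnj (L z0) \<noteq> 0" by (metis less_irrefl zero_complex.sel(1))
  qed
  define u where "u = (z - z0) / of_real r"
  have u: "norm u \<le> 1 / 5" using z \<open>r > 0\<close> by (simp add: u_def norm_divide field_simps)
  have zu: "z0 + of_real r * u = z" using \<open>r > 0\<close> by (simp add: u_def)
  have "norm (c u) \<le> norm u"
  proof (rule Schwarz_Lemma(1)[of c])
    have "(\<lambda>u. L (z0 + of_real r * u)) holomorphic_on ball 0 1"
      by (rule holomorphic_on_compose_gen[OF _ L, unfolded o_def])
        (use in_ball in \<open>auto intro!: holomorphic_intros\<close>)
    then show "c holomorphic_on ball 0 1"
      unfolding c_def using nz pos in_ball by (intro holomorphic_intros) auto
    show "norm (c u) < 1" if "norm u < 1" for u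
      using lt[OF pos[OF in_ball[OF that]]] by (simp add: c_def norm_divide divide_less_eq)
  qed (use u in \<open>auto simp: c_def\<close>)
  also have "\<dots> \<le> 1 / 5" by (rule u)
  finally have "norm (L z - L z0) / norm (L z + cnj (L z0)) \<le> 1 / 5"
    by (simp add: c_def zu norm_divide)
  moreover have "z \<in> ball z0 r" using z \<open>r > 0\<close> by (simp add: dist_norm norm_minus_commute)
  then have "norm (L z + cnj (L z0)) > 0" using nz[OF pos] by simp
  ultimately have "5 * norm (L z - L z0) \<le> norm (L z + cnj (L z0))" by (simp add: field_simps)
  also have "L z + cnj (L z0) = (L z - L z0) + of_real (2 * Re (L z0))"
    by (simp add: complex_eq_iff)
  also have "norm \<dots> \<le> norm (L z - L z0) + norm (of_real (2 * Re (L z0)) :: complex)"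
    by (rule norm_triangle_ineq)
  also have "norm (of_real (2 * Re (L z0)) :: complex) = 2 * Re (L z0)"
    using p0 by (simp only: norm_of_real)
  finally show ?thesis by simp
qed

text \<open>Cauchy's inequality on the circle of radius \<open>r / 5\<close>, where
  \<open>L - L z0\<close> is at most \<open>Re (L z0) / 2\<close> in modulus.\<close>

lemma half_plane_deriv_bound:
  assumes "r > 0" and L: "L holomorphic_on ball z0 r"
    and pos: "\<And>z. z \<in> ball z0 r \<Longrightarrow> Re (L z) > 0"
  shows "norm (deriv L z0) \<le> 5 / 2 * Re (L z0) / r"
proof -
  have sub: "cball z0 (r / 5) \<subseteq> ball z0 r" using \<open>r > 0\<close> by auto
  have hol: "(\<lambda>z. L z - L z0) holomorphic_on ball z0 r" using L by (intro holomorphic_intros)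
  have "norm ((deriv ^^ 1) (\<lambda>z. L z - L z0) z0) \<le> fact 1 * (Re (L z0) / 2) / (r / 5) ^ 1"
  proof (rule Cauchy_inequality)
    show "(\<lambda>z. L z - L z0) holomorphic_on ball z0 (r / 5)"
      using hol by (rule holomorphic_on_subset) (use sub ball_subset_cball in blast)
    show "continuous_on (cball z0 (r / 5)) (\<lambda>z. L z - L z0)"
      using hol sub holomorphic_on_imp_continuous_on holomorphic_on_subset by blast
    show "norm (L x - L z0) \<le> Re (L z0) / 2" if "norm (z0 - x) = r / 5" for x
      using half_plane_Harnack[OF assms, of x] that by (simp add: norm_minus_commute)
  qed (use \<open>r > 0\<close> in auto)
  moreover have "((\<lambda>z. L z - L z0) has_field_derivative deriv L z0) (at z0)"
    using holomorphic_derivI[OF L open_ball, of z0] \<open>r > 0\<close>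
    by (auto intro!: derivative_eq_intros)
  then have "deriv (\<lambda>z. L z - L z0) z0 = deriv L z0" by (rule DERIV_imp_deriv)
  ultimately show ?thesis by simp
qed

section \<open>Growth, orbits through compact sets, and spreading of large values\<close>

text \<open>If \<open>norm (f z) < \<rho>\<^sup>2\<close> held on arbitrarily large circles,
  Cauchy's inequality would annihilate every Taylor coefficient of order at least 3 and
  \<open>f\<close> would be a polynomial.\<close>

lemma transcendental_growth:
  assumes "transcendental_entire f"
  obtains \<rho>0 where "\<And>\<rho>. \<rho> \<ge> \<rho>0 \<Longrightarrow> \<exists>z. norm z = \<rho> \<and> norm (f z) \<ge> \<rho>\<^sup>2"
proof (rule ccontr)
  assume "\<not> thesis"
  then have small: "\<exists>\<rho>\<ge>\<rho>0. \<forall>z. norm z = \<rho> \<longrightarrow> norm (f z) < \<rho>\<^sup>2" for \<rho>0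
    using that by (meson not_le)
  have hol: "f holomorphic_on A" for A
    using assms holomorphic_on_subset by (auto simp: transcendental_entire_def entire_def)
  have zero: "(deriv ^^ n) f 0 = 0" if "n \<ge> 3" for n
  proof (rule ccontr)
    assume nz: "(deriv ^^ n) f 0 \<noteq> 0"
    define c where "c = norm ((deriv ^^ n) f 0)"
    have "c > 0" using nz by (simp add: c_def)
    obtain \<rho> where \<rho>: "\<rho> \<ge> max 1 (fact n / c + 1)" "\<And>z. norm z = \<rho> \<Longrightarrow> norm (f z) < \<rho>\<^sup>2"
      using small by blast
    have "\<rho> \<ge> 1" "\<rho> > fact n / c" using \<rho>(1) by auto
    have "c \<le> fact n * \<rho>\<^sup>2 / \<rho> ^ n"
      unfolding c_def
    proof (rule Cauchy_inequality)
      show "continuous_on (cball 0 \<rho>) f" using hol holomorphic_on_imp_continuous_on by blast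
    qed (use hol \<rho> \<open>\<rho> \<ge> 1\<close> in \<open>auto intro: less_imp_le\<close>)
    also have "\<dots> \<le> fact n * \<rho>\<^sup>2 / \<rho> ^ 3"
      using power_increasing[OF \<open>n \<ge> 3\<close> \<open>\<rho> \<ge> 1\<close>] \<open>\<rho> \<ge> 1\<close> by (intro divide_left_mono) auto
    also have "\<dots> = fact n / \<rho>" using \<open>\<rho> \<ge> 1\<close> by (simp add: power2_eq_square power3_eq_cube)
    finally have "\<rho> \<le> fact n / c" using \<open>c > 0\<close> \<open>\<rho> \<ge> 1\<close> by (simp add: field_simps)
    then show False using \<open>\<rho> > fact n / c\<close> by simp
  qed
  define p where "p = (\<Sum>n<3. monom ((deriv ^^ n) f 0 / fact n) n)"
  have "f z = poly p z" for z
  proof -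
    have "(\<lambda>n. (deriv ^^ n) f 0 / fact n * (z - 0) ^ n) sums f z"
      by (rule holomorphic_power_series[where r = "norm z + 1", OF hol]) (simp add: dist_norm)
    moreover have "(\<lambda>n. (deriv ^^ n) f 0 / fact n * (z - 0) ^ n) sums (\<Sum>n<3. (deriv ^^ n) f 0 / fact n * (z - 0) ^ n)"
      by (rule sums_finite) (use zero in auto)
    ultimately have "f z = (\<Sum>n<3. (deriv ^^ n) f 0 / fact n * (z - 0) ^ n)" by (rule sums_unique2)
    then show ?thesis by (simp only: p_def poly_sum poly_monom diff_zero)
  qed
  then show False using assms unfolding transcendental_entire_def by blast
qed

text \<open>The starting points whose first \<open>n\<close> iterates run through the prescribed
  sets form a decreasing sequence of compact sets, nonempty because each point of \<open>E n\<close>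
  can be pulled back step by step to \<open>E 0\<close>. Any point of the intersection
  works.\<close>

lemma compact_covering_orbit:
  fixes h :: "'a::heine_borel \<Rightarrow> 'a"
  assumes h: "continuous_on UNIV h" and E: "\<And>n. compact (E n)" "\<And>n. E n \<noteq> {}"
    and cov: "\<And>n. E (Suc n) \<subseteq> h ` E n"
  obtains x where "\<And>n. (h ^^ n) x \<in> E n"
proof -
  define K where "K n = (\<Inter>m\<le>n. E 0 \<inter> (h ^^ m) -` E m)" for n
  have cont: "continuous_on UNIV (h ^^ m)" for m
  proof (induction m)
    case (Suc m)
    then show ?case using continuous_on_compose2[OF h] by (simp add: o_def)
  qed (simp add: id_def)
  have "closed (E 0 \<inter> (h ^^ m) -` E m)" for m
    using cont E(1) by (intro closed_Int compact_imp_closed closed_vimage) auto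
  then have closedK: "closed (K n)" for n unfolding K_def by (intro closed_INT) auto
  have "K n \<subseteq> E 0" for n by (auto simp: K_def)
  then have "compact (K n)" for n using closedK E(1) compact_Int_closed[of "E 0" "K n"] by (simp add: Int_absorb1)
  moreover have "K n \<noteq> {}" for n
  proof -
    have "\<exists>x. (h ^^ n) x = y \<and> (\<forall>m\<le>n. (h ^^ m) x \<in> E m)" if "y \<in> E n" for y
      using that
    proof (induction n arbitrary: y)
      case (Suc n)
      then obtain y' where y': "y' \<in> E n" "h y' = y" using cov by blast
      then obtain x where "(h ^^ n) x = y'" "\<forall>m\<le>n. (h ^^ m) x \<in> E m" using Suc.IH by blast
      then show ?case using y' Suc.prems by (intro exI[of _ x]) (auto simp: le_Suc_eq)
    qed auto
    then obtain x where x: "\<forall>m\<le>n. (h ^^ m) x \<in> E m" using E(2)[of n] by blast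
    then have "x \<in> E 0" by (metis funpow_0 le0)
    then have "x \<in> K n" using x by (auto simp: K_def)
    then show ?thesis by blast
  qed
  moreover have "K n \<subseteq> K m" if "m \<le> n" for m n using that by (auto simp: K_def)
  ultimately have "\<Inter>(range K) \<noteq> {}" by (intro compact_nest) auto
  then obtain x where x: "\<And>n. x \<in> K n" by blast
  have "(h ^^ n) x \<in> E n" for n using x[of n] by (auto simp: K_def)
  then show thesis using that by blast
qed

text \<open>Normalising the omitted values to 0 and 1 so that a large \<open>\<phi>\<close> becomes
  a small \<open>q\<close>, Schottky's theorem bounds \<open>q\<close> near \<open>z0\<close>. A
  logarithm of \<open>q\<close> then maps into a half-plane, and Harnack's inequality transfers
  smallness from \<open>z0\<close> to nearby points. The bound \<open>A\<close> is uniform in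
  \<open>\<phi>\<close>, so that it serves all iterates at once.\<close>

lemma large_value_spreads:
  fixes a b :: complex
  assumes "a \<noteq> b" "\<rho> > 0"
  obtains A where "\<And>\<phi> z. \<phi> holomorphic_on ball z0 \<rho> \<Longrightarrow> (\<And>z. z \<in> ball z0 \<rho> \<Longrightarrow> \<phi> z \<noteq> a \<and> \<phi> z \<noteq> b) \<Longrightarrow>
    norm (\<phi> z0) \<ge> A \<Longrightarrow> z \<in> ball z0 (\<rho> / 20) \<Longrightarrow> norm (\<phi> z) > M"
proof -
  \<comment> \<open>Schottky's bound for functions of modulus at most 1 at the centre, on the disc
    of half the radius.\<close>
  define B where "B = exp (pi * exp (pi * (2 + 2 * 1 + 12 * (1/2) / (1 - 1/2 :: real))))"
  have "B > 0" by (simp add: B_def)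
  \<comment> \<open>The second summand ensures \<open>norm (q z0) \<le> 1\<close>; the last one
    makes \<open>norm (b - a) * norm (\<phi> z0 - a)\<close> exceed
    \<open>2 * B * (\<bar>M\<bar> + norm a + 1)\<^sup>2\<close>, which the final comparison
    needs.\<close>
  define A where "A = norm a + norm (b - a) + 2 * B * (\<bar>M\<bar> + norm a + 1)\<^sup>2 / norm (b - a)"
  have dpos: "norm (b - a) > 0" using \<open>a \<noteq> b\<close> by simp
  have "norm (\<phi> z) > M" if \<phi>: "\<phi> holomorphic_on ball z0 \<rho>"
    and omit: "\<And>z. z \<in> ball z0 \<rho> \<Longrightarrow> \<phi> z \<noteq> a \<and> \<phi> z \<noteq> b"
    and big: "norm (\<phi> z0) \<ge> A" and z: "z \<in> ball z0 (\<rho> / 20)" for \<phi> z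
  proof -
    define q where "q x = (b - a) / (\<phi> x - a)" for x
    have q: "q x \<noteq> 0" "q x \<noteq> 1" if "x \<in> ball z0 \<rho>" for x
      using omit[OF that] \<open>a \<noteq> b\<close> by (auto simp: q_def)
    have holq: "q holomorphic_on ball z0 \<rho>"
      unfolding q_def using omit by (intro holomorphic_intros \<phi>) auto
    have "norm (\<phi> z0) - norm a \<le> norm (\<phi> z0 - a)" by (rule norm_triangle_ineq2)
    then have far: "norm (b - a) + 2 * B * (\<bar>M\<bar> + norm a + 1)\<^sup>2 / norm (b - a) \<le> norm (\<phi> z0 - a)"
      using big by (simp add: A_def)
    have "2 * B * (\<bar>M\<bar> + norm a + 1)\<^sup>2 / norm (b - a) \<ge> 0" using \<open>B > 0\<close> by simp
    then have "norm (b - a) \<le> norm (\<phi> z0 - a)" using far by linarith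
    then have q0: "norm (q z0) \<le> 1" using dpos by (simp add: q_def norm_divide divide_le_eq)
    have qB: "norm (q x) \<le> B" if x: "x \<in> ball z0 (\<rho> / 4)" for x
    proof -
      define Q where "Q u = q (z0 + of_real (\<rho> / 2) * u)" for u
      have inb: "z0 + of_real (\<rho> / 2) * u \<in> ball z0 \<rho>" if "u \<in> cball 0 1" for u
      proof -
        have "norm (of_real (\<rho> / 2) * u) \<le> \<rho> / 2"
          using that \<open>\<rho> > 0\<close> by (simp add: norm_mult mult_le_cancel_left1 del: of_real_divide)
        then show ?thesis using \<open>\<rho> > 0\<close> by (simp add: dist_norm)
      qed
      define u where "u = (x - z0) / of_real (\<rho> / 2)"
      have "norm u = norm (x - z0) / (\<rho> / 2)" using \<open>\<rho> > 0\<close>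
        by (simp add: u_def norm_divide del: of_real_divide)
      also have "\<dots> \<le> 1 / 2" using x \<open>\<rho> > 0\<close>
        by (simp add: dist_norm norm_minus_commute field_simps)
      finally have "norm u \<le> 1 / 2" .
      have "norm (Q u) \<le> B"
        unfolding B_def
      proof (rule Schottky[of Q 1 "1/2" u])
        show "Q holomorphic_on cball 0 1"
          unfolding Q_def by (rule holomorphic_on_compose_gen[OF _ holq, unfolded o_def])
            (use inb in \<open>auto intro!: holomorphic_intros\<close>)
        show "\<not> (Q u = 0 \<or> Q u = 1)" if "u \<in> cball 0 1" for u
          using q[OF inb[OF that]] by (simp add: Q_def)
      qed (use q0 \<open>norm u \<le> 1 / 2\<close> in \<open>auto simp: Q_def\<close>)
      moreover have "Q u = q x" using \<open>\<rho> > 0\<close> by (simp add: Q_def u_def del: of_real_divide)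
      ultimately show ?thesis by simp
    qed
    have sub: "ball z0 (\<rho> / 4) \<subseteq> ball z0 \<rho>" using \<open>\<rho> > 0\<close> by (intro subset_ball) simp
    obtain l where l: "l holomorphic_on ball z0 (\<rho> / 4)" "\<And>x. x \<in> ball z0 (\<rho> / 4) \<Longrightarrow> q x = exp (l x)"
      using contractible_imp_holomorphic_log[OF holomorphic_on_subset[OF holq sub]
          convex_imp_contractible[OF convex_ball]] q sub by (metis subsetD)
    \<comment> \<open>The factor 2 makes the real part strictly positive, as
      \<open>norm (q x) \<le> B < 2 * B\<close>.\<close>
    define L where "L x = of_real (ln (2 * B)) - l x" for x
    have ReL: "Re (L x) = ln (2 * B) - ln (norm (q x))" if "x \<in> ball z0 (\<rho> / 4)" for x
      using l(2)[OF that] by (simp add: L_def)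
    have posL: "Re (L x) > 0" if "x \<in> ball z0 (\<rho> / 4)" for x
    proof -
      have "norm (q x) > 0" using q that sub by auto
      moreover have "norm (q x) < 2 * B" using qB[OF that] \<open>B > 0\<close> by simp
      ultimately have "ln (norm (q x)) < ln (2 * B)" using \<open>B > 0\<close> by (subst ln_less_cancel_iff) auto
      then show ?thesis using ReL[OF that] by simp
    qed
    have z0b: "z0 \<in> ball z0 (\<rho> / 4)" using \<open>\<rho> > 0\<close> by simp
    have zb: "z \<in> ball z0 (\<rho> / 4)" using z \<open>\<rho> > 0\<close> by auto
    have "norm (L z - L z0) \<le> Re (L z0) / 2"
    proof (rule half_plane_Harnack[of "\<rho> / 4" L z0 z])
      show "L holomorphic_on ball z0 (\<rho> / 4)" unfolding L_def by (intro holomorphic_intros l)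
    qed (use posL z \<open>\<rho> > 0\<close> in \<open>auto simp: dist_norm norm_minus_commute\<close>)
    then have "Re (L z0) / 2 \<le> Re (L z)" using abs_Re_le_cmod[of "L z - L z0"] by simp
    \<comment> \<open>Harnack's inequality \<open>Re (L z0) / 2 \<le> Re (L z)\<close> in terms of
      \<open>q\<close>; exponentiated, it says that \<open>q z\<close> is at most of the order of
      the square root of \<open>q z0\<close>.\<close>
    then have "2 * ln (norm (q z)) \<le> ln (2 * B) + ln (norm (q z0))"
      using ReL[OF zb] ReL[OF z0b] by simp
    moreover have qz: "norm (q z) > 0" "norm (q z0) > 0" using q zb z0b sub by (metis subsetD zero_less_norm_iff)+
    ultimately have "ln ((norm (q z))\<^sup>2) \<le> ln (2 * B * norm (q z0))"
      using \<open>B > 0\<close> by (simp add: ln_mult ln_realpow)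
    then have le: "(norm (q z))\<^sup>2 \<le> 2 * B * norm (q z0)"
      using qz \<open>B > 0\<close> by (subst (asm) ln_le_cancel_iff) auto
    define m where "m = norm (\<phi> z - a)"
    have "m > 0" "norm (\<phi> z0 - a) > 0" using qz by (auto simp: m_def q_def)
    have "(norm (b - a))\<^sup>2 / m\<^sup>2 \<le> 2 * B * (norm (b - a) / norm (\<phi> z0 - a))"
      using le by (simp add: q_def m_def norm_divide power_divide)
    then have "norm (b - a) * norm (\<phi> z0 - a) \<le> 2 * B * m\<^sup>2"
      using dpos \<open>m > 0\<close> \<open>norm (\<phi> z0 - a) > 0\<close> by (simp add: field_simps power2_eq_square)
    moreover have "2 * B * (\<bar>M\<bar> + norm a + 1)\<^sup>2 < norm (b - a) * norm (\<phi> z0 - a)"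
    proof -
      have "2 * B * (\<bar>M\<bar> + norm a + 1)\<^sup>2 / norm (b - a) < norm (\<phi> z0 - a)" using far dpos by linarith
      then show ?thesis using dpos by (simp add: divide_less_eq mult.commute)
    qed
    ultimately have "2 * B * (\<bar>M\<bar> + norm a + 1)\<^sup>2 < 2 * B * m\<^sup>2" by linarith
    then have "(\<bar>M\<bar> + norm a + 1)\<^sup>2 < m\<^sup>2" using \<open>B > 0\<close> by simp
    then have "\<bar>M\<bar> + norm a + 1 < m" using \<open>m > 0\<close> by (simp add: power_less_imp_less_base)
    then show ?thesis using norm_triangle_ineq4[of "\<phi> z" a] unfolding m_def by linarith
  qed
  then show thesis using that by blast
qed

subsection \<open>Escaping points\<close>

lemma bounded_type_radius:
  assumes "bounded_type f"
  obtains R where "R \<ge> 1" "norm (f 0) \<le> R" "critical_values f \<union> asymptotic_values f \<subseteq> cball 0 R"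
proof -
  have "bounded (critical_values f \<union> asymptotic_values f)"
    using assms unfolding bounded_type_def by (meson bounded_subset closure_subset)
  then obtain B where B: "\<And>x. x \<in> critical_values f \<union> asymptotic_values f \<Longrightarrow> norm x \<le> B"
    unfolding bounded_iff by blast
  show thesis
    by (rule that[of "max B (max 1 (norm (f 0)))"]) (use B in \<open>auto simp: le_max_iff_disj\<close>)
qed

text \<open>Differentiating \<open>f (exp (\<Phi> \<omega>)) = exp \<omega>\<close> at a logarithm
  \<open>\<omega>\<close> of \<open>f z\<close> gives
  \<open>f z = deriv f z * z * deriv \<Phi> \<omega>\<close>; the upper bound on
  \<open>deriv \<Phi>\<close> becomes a lower bound on \<open>deriv f\<close>.\<close>

lemma logarithmic_expansion:
  assumes f: "transcendental_entire f"
    and sing: "critical_values f \<union> asymptotic_values f \<subseteq> cball 0 R" and R: "norm (f 0) \<le> R" "R > 0"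
    and z: "norm (f z) > R"
  shows "norm (f z) * (ln (norm (f z)) - ln R) \<le> norm (deriv f z) * norm z * (12 * pi)"
proof -
  have hol: "f holomorphic_on UNIV" using f by (simp add: transcendental_entire_def entire_def)
  have "f z \<noteq> 0" using z R by auto
  define \<omega> where "\<omega> = Ln (f z)"
  have e: "exp \<omega> = f z" using \<open>f z \<noteq> 0\<close> by (simp add: \<omega>_def)
  have Re: "Re \<omega> = ln (norm (f z))" using \<open>f z \<noteq> 0\<close> by (simp add: \<omega>_def)
  obtain \<Phi> where \<Phi>: "\<Phi> holomorphic_on {\<omega>. Re \<omega> > ln R}" "exp (\<Phi> \<omega>) = z"
    "\<And>\<omega>. Re \<omega> > ln R \<Longrightarrow> f (exp (\<Phi> \<omega>)) = exp \<omega>"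
    "\<And>\<omega>. Re \<omega> > ln R \<Longrightarrow> norm (deriv \<Phi> \<omega>) * (Re \<omega> - ln R) \<le> 12 * pi"
    using logarithmic_tract[OF f sing R z e] by blast
  have in_H: "Re \<omega> > ln R" using z R \<open>f z \<noteq> 0\<close> by (simp add: Re)
  have "(\<Phi> has_field_derivative deriv \<Phi> \<omega>) (at \<omega>)"
    using \<Phi>(1) holomorphic_derivI[OF _ open_halfspace_Re_gt] in_H by blast
  then have "((\<lambda>\<omega>. exp (\<Phi> \<omega>)) has_field_derivative z * deriv \<Phi> \<omega>) (at \<omega>)"
    using \<Phi>(2) by (auto intro!: derivative_eq_intros)
  moreover have "(f has_field_derivative deriv f z) (at (exp (\<Phi> \<omega>)))"
    using holomorphic_derivI[OF hol open_UNIV] \<Phi>(2) by auto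
  ultimately have "((\<lambda>\<omega>. f (exp (\<Phi> \<omega>))) has_field_derivative deriv f z * (z * deriv \<Phi> \<omega>)) (at \<omega>)"
    using DERIV_chain2[of f "deriv f z" "\<lambda>\<omega>. exp (\<Phi> \<omega>)" \<omega> "z * deriv \<Phi> \<omega>" UNIV] by blast
  moreover have "((\<lambda>\<omega>. f (exp (\<Phi> \<omega>))) has_field_derivative exp \<omega>) (at \<omega>)"
    by (rule has_field_derivative_transform_within_open[OF DERIV_exp open_halfspace_Re_gt[of "ln R"]])
      (use in_H \<Phi>(3) in auto)
  ultimately have "f z = deriv f z * (z * deriv \<Phi> \<omega>)" using e DERIV_unique by metis
  then have "norm (f z) = norm (deriv f z) * norm z * norm (deriv \<Phi> \<omega>)"
    by (metis norm_mult mult.assoc)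
  then have "norm (f z) * (ln (norm (f z)) - ln R)
      = norm (deriv f z) * norm z * (norm (deriv \<Phi> \<omega>) * (Re \<omega> - ln R))"
    by (simp add: Re)
  also have "\<dots> \<le> norm (deriv f z) * norm z * (12 * pi)"
    by (rule mult_left_mono[OF \<Phi>(4)[OF in_H]]) simp
  finally show ?thesis .
qed

section \<open>Discs in the logarithmic coordinate and an escaping point of the composition\<close>

text \<open>In the logarithmic coordinate this is the closed unit disc about a logarithm of
  \<open>z\<close>; its size is proportional to \<open>norm z\<close>, which makes covering
  statements independent of scale.\<close>

definition exp_disc :: "complex \<Rightarrow> complex set" where
  "exp_disc z = (\<lambda>u. z * exp u) ` cball 0 1"

lemma compact_exp_disc: "compact (exp_disc z)"
  unfolding exp_disc_def by (intro compact_continuous_image continuous_intros compact_cball)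

lemma exp_disc_nonempty: "exp_disc z \<noteq> {}"
  by (simp add: exp_disc_def)

lemma norm_exp_disc_ge:
  assumes "x \<in> exp_disc z"
  shows "norm x \<ge> norm z * exp (- 1)"
proof -
  obtain u where u: "norm u \<le> 1" "x = z * exp u" using assms by (auto simp: exp_disc_def)
  have "exp (- 1) \<le> exp (Re u)" using abs_Re_le_cmod[of u] u(1) by simp
  then show ?thesis using u(2) by (simp add: norm_mult mult_left_mono)
qed

text \<open>A rotation from \<open>f z\<close> to \<open>w\<close> costs at most 4 in the
  logarithmic coordinate and the disc about \<open>w\<close> another 1, so logarithms within 5 of
  that of \<open>f z\<close> suffice. There the real part exceeds \<open>ln R\<close> by at least
  \<open>60 * pi\<close>, hence \<open>deriv \<Phi>\<close> is at most 1/5 and the preimages stay in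
  a unit disc. Only the modulus of \<open>w\<close> matters, so \<open>w\<close> may be chosen as a
  point of large growth on its circle.\<close>

lemma exp_disc_covered:
  assumes f: "transcendental_entire f"
    and sing: "critical_values f \<union> asymptotic_values f \<subseteq> cball 0 R" and R: "norm (f 0) \<le> R" "R > 0"
    and z: "norm (f z) \<ge> R * exp (5 + 60 * pi)" and w: "norm w = norm (f z)"
  shows "exp_disc w \<subseteq> f ` exp_disc z"
proof
  fix y assume "y \<in> exp_disc w"
  then obtain u where u: "norm u \<le> 1" "y = w * exp u" by (auto simp: exp_disc_def)
  have fz: "norm (f z) > R"
  proof -
    have "5 + 60 * pi > 0" using pi_gt_zero by linarith
    then have "exp (5 + 60 * pi) > 1" by simp
    then have "R * 1 < R * exp (5 + 60 * pi)" using R(2) by (intro mult_strict_left_mono) auto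
    then show ?thesis using z by simp
  qed
  then have "f z \<noteq> 0" "w \<noteq> 0" using R w by auto
  define \<omega> where "\<omega> = Ln (f z)"
  have e: "exp \<omega> = f z" using \<open>f z \<noteq> 0\<close> by (simp add: \<omega>_def)
  have "Re \<omega> = ln (norm (f z))" using \<open>f z \<noteq> 0\<close> by (simp add: \<omega>_def)
  moreover have "ln (norm (f z)) \<ge> ln (R * exp (5 + 60 * pi))"
    using z R(2) fz by (subst ln_le_cancel_iff) auto
  ultimately have Re: "Re \<omega> \<ge> ln R + 5 + 60 * pi" using R(2) by (simp add: ln_mult)
  obtain \<Phi> where \<Phi>: "\<Phi> holomorphic_on {\<omega>. Re \<omega> > ln R}" "exp (\<Phi> \<omega>) = z"
    "\<And>\<omega>. Re \<omega> > ln R \<Longrightarrow> f (exp (\<Phi> \<omega>)) = exp \<omega>"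
    "\<And>\<omega>. Re \<omega> > ln R \<Longrightarrow> norm (deriv \<Phi> \<omega>) * (Re \<omega> - ln R) \<le> 12 * pi"
    using logarithmic_tract[OF f sing R fz e] by blast
  \<comment> \<open>The rotation from \<open>f z\<close> to \<open>w\<close>: purely imaginary
    because the moduli agree.\<close>
  define \<theta> where "\<theta> = Ln (w / f z)"
  have "Re \<theta> = 0" "\<bar>Im \<theta>\<bar> \<le> pi"
    using \<open>f z \<noteq> 0\<close> \<open>w \<noteq> 0\<close> w mpi_less_Im_Ln[of "w / f z"] Im_Ln_le_pi[of "w / f z"]
    by (auto simp: \<theta>_def norm_divide)
  then have "norm \<theta> \<le> 4" using cmod_le[of \<theta>] pi_less_4 by linarith
  define \<omega>' where "\<omega>' = \<omega> + (\<theta> + u)"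
  have "exp \<theta> = w / f z" using \<open>f z \<noteq> 0\<close> \<open>w \<noteq> 0\<close> by (simp add: \<theta>_def)
  then have y: "exp \<omega>' = y" using u(2) \<open>f z \<noteq> 0\<close> e by (simp add: \<omega>'_def exp_add)
  have n5: "norm (\<theta> + u) \<le> 5" using norm_triangle_ineq[of \<theta> u] \<open>norm \<theta> \<le> 4\<close> u(1) by linarith
  have deep: "Re x \<ge> ln R + 60 * pi" if "x \<in> cball \<omega> 5" for x
    using that abs_Re_le_cmod[of "\<omega> - x"] Re by (simp add: dist_norm)
  have "60 * pi > 0" by simp
  have in_H: "Re x > ln R" if "x \<in> cball \<omega> 5" for x using deep[OF that] \<open>60 * pi > 0\<close> by linarith
  have in5: "\<omega>' \<in> cball \<omega> 5" using n5 norm_minus_cancel[of "\<theta> + u"] by (simp add: \<omega>'_def dist_norm)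
  have "norm (\<Phi> \<omega>' - \<Phi> \<omega>) \<le> 1 / 5 * norm (\<omega>' - \<omega>)"
  proof (rule field_differentiable_bound[OF convex_cball, of \<omega> 5 \<Phi> "deriv \<Phi>"])
    fix x assume x: "x \<in> cball \<omega> 5"
    show "(\<Phi> has_field_derivative deriv \<Phi> x) (at x within cball \<omega> 5)"
      using \<Phi>(1) holomorphic_derivI[OF _ open_halfspace_Re_gt] in_H[OF x] has_field_derivative_at_within
      by blast
    have "norm (deriv \<Phi> x) * (60 * pi) \<le> norm (deriv \<Phi> x) * (Re x - ln R)"
      using deep[OF x] by (intro mult_left_mono) auto
    also have "\<dots> \<le> 12 * pi" by (rule \<Phi>(4)[OF in_H[OF x]])
    finally show "norm (deriv \<Phi> x) \<le> 1 / 5" using pi_gt_zero by (simp add: field_simps)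
  qed (use in5 in auto)
  also have "\<dots> \<le> 1" using n5 by (simp add: \<omega>'_def)
  finally have "\<Phi> \<omega>' - \<Phi> \<omega> \<in> cball 0 1" by simp
  moreover have "exp (\<Phi> \<omega>') = z * exp (\<Phi> \<omega>' - \<Phi> \<omega>)"
    unfolding \<Phi>(2)[symmetric] exp_add[symmetric] by simp
  ultimately have "exp (\<Phi> \<omega>') \<in> exp_disc z" unfolding exp_disc_def by blast
  moreover have "f (exp (\<Phi> \<omega>')) = y" using \<Phi>(3)[OF in_H[OF in5]] y by simp
  ultimately show "y \<in> f ` exp_disc z" by blast
qed

text \<open>From a point where \<open>g\<close> is large one passes to a point of the same modulus
  as its image where \<open>f\<close> is large, and from there back to one for \<open>g\<close>.
  Each double step covers the next disc by the image of the previous one and at least doubles the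
  modulus, so an orbit through the chain of discs escapes.\<close>

lemma escaping_set_compose_nonempty:
  assumes "bounded_type f" "bounded_type g"
  shows "escaping_set (f \<circ> g) \<noteq> {}"
proof -
  have f: "transcendental_entire f" and g: "transcendental_entire g"
    using assms by (auto simp: bounded_type_def)
  obtain Rf where Rf: "Rf \<ge> 1" "norm (f 0) \<le> Rf" "critical_values f \<union> asymptotic_values f \<subseteq> cball 0 Rf"
    using bounded_type_radius[OF assms(1)] by blast
  obtain Rg where Rg: "Rg \<ge> 1" "norm (g 0) \<le> Rg" "critical_values g \<union> asymptotic_values g \<subseteq> cball 0 Rg"
    using bounded_type_radius[OF assms(2)] by blast
  obtain \<rho>f where \<rho>f: "\<And>\<rho>. \<rho> \<ge> \<rho>f \<Longrightarrow> \<exists>z. norm z = \<rho> \<and> norm (f z) \<ge> \<rho>\<^sup>2"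
    using transcendental_growth[OF f] by blast
  obtain \<rho>g where \<rho>g: "\<And>\<rho>. \<rho> \<ge> \<rho>g \<Longrightarrow> \<exists>z. norm z = \<rho> \<and> norm (g z) \<ge> \<rho>\<^sup>2"
    using transcendental_growth[OF g] by blast
  \<comment> \<open>Beyond \<open>K\<close> both growth statements apply,
    \<open>\<rho>\<^sup>2\<close> is at least \<open>2 * \<rho>\<close>, and image points are large
    enough for the covering of discs by \<open>f\<close> and by \<open>g\<close>.\<close>
  define K where "K = Max {\<rho>f, \<rho>g, 2, Rf * exp (5 + 60 * pi), Rg * exp (5 + 60 * pi)}"
  have K: "\<rho>f \<le> K" "\<rho>g \<le> K" "2 \<le> K" "Rf * exp (5 + 60 * pi) \<le> K" "Rg * exp (5 + 60 * pi) \<le> K"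
    unfolding K_def by (rule Max_ge; simp)+
  have sq: "2 * \<rho> \<le> \<rho>\<^sup>2" if "\<rho> \<ge> K" for \<rho>
    using that K(3) by (simp add: power2_eq_square)
  define good where "good z \<longleftrightarrow> norm z \<ge> K \<and> norm (g z) \<ge> (norm z)\<^sup>2" for z
  have step: "\<exists>z'. good z' \<and> norm z' \<ge> 2 * norm z \<and> exp_disc z' \<subseteq> (f \<circ> g) ` exp_disc z"
    if "good z" for z
  proof -
    have z: "norm z \<ge> K" "norm (g z) \<ge> (norm z)\<^sup>2" using that by (auto simp: good_def)
    have gz: "norm (g z) \<ge> 2 * norm z" using sq[OF z(1)] z(2) by linarith
    then have "norm (g z) \<ge> K" using z(1) K(3) by linarith
    then obtain w where w: "norm w = norm (g z)" "norm (f w) \<ge> (norm w)\<^sup>2"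
      using \<rho>f[of "norm (g z)"] K(1) by auto
    have fw: "norm (f w) \<ge> 2 * norm w" using sq[of "norm w"] w \<open>norm (g z) \<ge> K\<close> by simp
    then have "norm (f w) \<ge> K" using w(1) \<open>norm (g z) \<ge> K\<close> K(3) by linarith
    then obtain z' where z': "norm z' = norm (f w)" "norm (g z') \<ge> (norm z')\<^sup>2"
      using \<rho>g[of "norm (f w)"] K(2) by auto
    have "exp_disc w \<subseteq> g ` exp_disc z"
      using exp_disc_covered[OF g Rg(3,2) _ _ w(1)] Rg(1) K(5) \<open>norm (g z) \<ge> K\<close> by linarith
    moreover have "exp_disc z' \<subseteq> f ` exp_disc w"
      using exp_disc_covered[OF f Rf(3,2) _ _ z'(1)] Rf(1) K(4) \<open>norm (f w) \<ge> K\<close> by linarith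
    ultimately have "exp_disc z' \<subseteq> (f \<circ> g) ` exp_disc z" by (fastforce simp: image_comp[symmetric])
    moreover have "good z'" using z' \<open>norm (f w) \<ge> K\<close> by (simp add: good_def)
    moreover have "norm z' \<ge> 2 * norm z" using z'(1) fw w(1) gz norm_ge_zero[of z] by linarith
    ultimately show ?thesis by blast
  qed
  obtain z0 where "good z0" using \<rho>g[OF K(2)] by (auto simp: good_def)
  then obtain Z where Z: "\<And>n. good (Z n)" "\<And>n. norm (Z (Suc n)) \<ge> 2 * norm (Z n)"
    "\<And>n. exp_disc (Z (Suc n)) \<subseteq> (f \<circ> g) ` exp_disc (Z n)"
    using dependent_nat_choice[of "\<lambda>n z. good z" "\<lambda>n z z'. norm z' \<ge> 2 * norm z \<and> exp_disc z' \<subseteq> (f \<circ> g) ` exp_disc z"]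
      step by (metis (no_types, lifting))
  have "continuous_on UNIV (f \<circ> g)"
    using f g unfolding transcendental_entire_def entire_def
    by (metis continuous_on_compose continuous_on_subset holomorphic_on_imp_continuous_on subset_UNIV)
  then obtain x where x: "\<And>n. ((f \<circ> g) ^^ n) x \<in> exp_disc (Z n)"
    using compact_covering_orbit[of "f \<circ> g" "\<lambda>n. exp_disc (Z n)"] compact_exp_disc exp_disc_nonempty Z(3)
    by blast
  have "norm (Z n) \<ge> 2 ^ n" for n
  proof (induction n)
    case 0 then show ?case using Z(1)[of 0] K(3) by (simp add: good_def)
  next
    case (Suc n) then show ?case using Z(2)[of n] by simp
  qed
  then have lower: "norm (((f \<circ> g) ^^ n) x) \<ge> 2 ^ n * exp (- 1)" for n
    using norm_exp_disc_ge[OF x[of n]] by (meson exp_ge_zero mult_right_mono order_trans)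
  have "filterlim (\<lambda>n. 2 ^ n * exp (- 1) :: real) at_top sequentially"
    by real_asymp
  then have "filterlim (\<lambda>n. norm (((f \<circ> g) ^^ n) x)) at_top sequentially"
    by (rule filterlim_at_top_mono) (rule always_eventually, rule allI, rule lower)
  then have "x \<in> escaping_set (f \<circ> g)"
    unfolding escaping_set_def mem_Collect_eq by (rule filterlim_norm_at_top_imp_at_infinity)
  then show ?thesis by blast
qed

section \<open>Expansion against the Schwarz lemma along an escaping orbit\<close>

text \<open>If the iterates omitted both values on the disc, they would eventually be large on a
  fixed smaller disc, and the logarithmic derivatives \<open>D n\<close> at \<open>z0\<close> would
  be at most a constant times \<open>s n\<close>. Expansion bounds \<open>s (Suc n) * D n\<close> by
  a multiple of \<open>D (Suc n)\<close>, so together \<open>D n\<close> stays bounded; yet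
  expansion alone makes \<open>D n\<close> double at each late step.\<close>

lemma escaping_orbit_hits_two_points:
  assumes f: "transcendental_entire f"
    and sing: "critical_values f \<union> asymptotic_values f \<subseteq> cball 0 R" and R: "norm (f 0) \<le> R" "R \<ge> 1"
    and z0: "z0 \<in> escaping_set f" "\<And>n. norm ((f ^^ n) z0) > R"
    and "\<rho> > 0" "a \<noteq> b"
  shows "\<exists>n. \<exists>z\<in>ball z0 \<rho>. (f ^^ n) z = a \<or> (f ^^ n) z = b"
proof (rule ccontr)
  assume "\<not> ?thesis"
  then have omit: "(f ^^ n) z \<noteq> a \<and> (f ^^ n) z \<noteq> b" if "z \<in> ball z0 \<rho>" for n z using that by blast
  have hol: "f holomorphic_on UNIV" using f by (simp add: transcendental_entire_def entire_def)
  have holn: "(f ^^ n) holomorphic_on A" for n A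
  proof -
    have "(f ^^ n) holomorphic_on UNIV"
    proof (induction n)
      case (Suc n)
      then show ?case using holomorphic_on_compose[OF Suc holomorphic_on_subset[OF hol subset_UNIV]] by (simp add: o_def)
    qed (simp add: id_def)
    then show ?thesis using holomorphic_on_subset by blast
  qed
  have esc: "filterlim (\<lambda>n. (f ^^ n) z0) at_infinity sequentially"
    using z0(1) by (simp add: escaping_set_def)
  define r where "r = \<rho> / 20"
  have "r > 0" using \<open>\<rho> > 0\<close> by (simp add: r_def)
  obtain A where A: "\<And>\<phi> z. \<phi> holomorphic_on ball z0 \<rho> \<Longrightarrow> (\<And>z. z \<in> ball z0 \<rho> \<Longrightarrow> \<phi> z \<noteq> a \<and> \<phi> z \<noteq> b) \<Longrightarrow>
    norm (\<phi> z0) \<ge> A \<Longrightarrow> z \<in> ball z0 r \<Longrightarrow> norm (\<phi> z) > R"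
    using large_value_spreads[OF \<open>a \<noteq> b\<close> \<open>\<rho> > 0\<close>, of z0 R] unfolding r_def by blast
  \<comment> \<open>\<open>D n\<close> is the modulus of the derivative at \<open>z0\<close> of a
    logarithm of \<open>f ^^ n\<close>, and \<open>s n\<close> is the distance of that logarithm
    from the boundary of the half-plane \<open>Re > ln R\<close>.\<close>
  define D where "D n = norm (deriv (f ^^ n) z0) / norm ((f ^^ n) z0)" for n
  define s where "s n = ln (norm ((f ^^ n) z0)) - ln R" for n
  have nz: "(f ^^ n) z0 \<noteq> 0" for n using z0(2)[of n] R(2) by auto
  have s_pos: "s n > 0" for n using z0(2)[of n] R(2) nz[of n] by (simp add: s_def)
  have grow: "s (Suc n) * D n \<le> 12 * pi * D (Suc n)" for n
  proof -
    define w where "w = (f ^^ n) z0"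
    have fw: "f w = (f ^^ Suc n) z0" by (simp add: w_def)
    have "((f ^^ n) has_field_derivative deriv (f ^^ n) z0) (at z0)"
      using holomorphic_derivI[OF holn open_UNIV] by blast
    moreover have "(f has_field_derivative deriv f w) (at ((f ^^ n) z0))"
      using holomorphic_derivI[OF hol open_UNIV] unfolding w_def by blast
    ultimately have "(f \<circ> (f ^^ n) has_field_derivative deriv f w * deriv (f ^^ n) z0) (at z0)"
      using DERIV_chain by blast
    then have d: "deriv (f ^^ Suc n) z0 = deriv f w * deriv (f ^^ n) z0" by (simp add: DERIV_imp_deriv)
    have "norm (f w) * s (Suc n) \<le> norm (deriv f w) * norm w * (12 * pi)"
      using logarithmic_expansion[OF f sing R(1), of w] R(2) z0(2)[of "Suc n"] fw by (simp add: s_def)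
    then have "norm (f w) * s (Suc n) * norm (deriv (f ^^ n) z0)
        \<le> norm (deriv f w) * norm w * (12 * pi) * norm (deriv (f ^^ n) z0)"
      by (rule mult_right_mono) simp
    then show ?thesis
      using nz[of n] nz[of "Suc n"] unfolding D_def d norm_mult fw[symmetric] w_def[symmetric]
      by (simp add: field_simps)
  qed
  have D_pos: "D n > 0" for n
  proof (induction n)
    case 0
    then show ?case using nz[of 0] by (simp add: D_def)
  next
    case (Suc n)
    then have "0 < s (Suc n) * D n" using s_pos by simp
    then have "0 < 12 * pi * D (Suc n)" using grow[of n] by linarith
    then show ?case by (simp add: zero_less_mult_iff)
  qed
  have upper: "D n \<le> 5 / 2 * s n / r" if "norm ((f ^^ n) z0) \<ge> A" for n
  proof -
    have big: "norm ((f ^^ n) z) > R" if "z \<in> ball z0 r" for z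
      using A[OF holn _ \<open>norm ((f ^^ n) z0) \<ge> A\<close> that] omit by blast
    then have "(f ^^ n) z \<noteq> 0" if "z \<in> ball z0 r" for z using that R(2) by fastforce
    then obtain l where l: "l holomorphic_on ball z0 r" "\<And>z. z \<in> ball z0 r \<Longrightarrow> (f ^^ n) z = exp (l z)"
      using contractible_imp_holomorphic_log[OF holn convex_imp_contractible[OF convex_ball]] by metis
    define L where "L z = l z - of_real (ln R)" for z
    have ReL: "Re (L z) = ln (norm ((f ^^ n) z)) - ln R" if "z \<in> ball z0 r" for z
      using l(2)[OF that] by (simp add: L_def)
    have z0r: "z0 \<in> ball z0 r" using \<open>r > 0\<close> by simp
    have "norm (deriv L z0) \<le> 5 / 2 * Re (L z0) / r"
    proof (rule half_plane_deriv_bound[of r L z0, OF \<open>r > 0\<close>])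
      show "L holomorphic_on ball z0 r" unfolding L_def by (intro holomorphic_intros l)
      show "Re (L z) > 0" if "z \<in> ball z0 r" for z
      proof -
        have "ln R < ln (norm ((f ^^ n) z))" using big[OF that] R(2) by (subst ln_less_cancel_iff) auto
        then show ?thesis using ReL[OF that] by simp
      qed
    qed
    moreover have "norm (deriv L z0) = D n"
    proof -
      have dl: "(l has_field_derivative deriv l z0) (at z0)"
        using holomorphic_derivI[OF l(1) open_ball z0r] .
      then have "deriv L z0 = deriv l z0"
        unfolding L_def by (intro DERIV_imp_deriv) (auto intro!: derivative_eq_intros)
      moreover have "((\<lambda>z. exp (l z)) has_field_derivative (f ^^ n) z0 * deriv l z0) (at z0)"
        using dl l(2)[OF z0r] by (auto intro!: derivative_eq_intros)
      then have "((f ^^ n) has_field_derivative (f ^^ n) z0 * deriv l z0) (at z0)"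
        by (rule has_field_derivative_transform_within_open[OF _ open_ball z0r]) (use l(2) in auto)
      then have "deriv (f ^^ n) z0 = (f ^^ n) z0 * deriv l z0" by (rule DERIV_imp_deriv)
      ultimately show ?thesis using nz[of n] by (simp add: D_def norm_mult)
    qed
    ultimately show ?thesis using ReL[OF z0r] by (simp add: s_def)
  qed
  have "filterlim (\<lambda>n. norm ((f ^^ n) z0)) at_top sequentially"
    using esc filterlim_at_infinity_imp_norm_at_top by blast
  \<comment> \<open>Beyond \<open>A\<close> the upper estimate applies; the other threshold gives
    \<open>s n \<ge> 24 * pi\<close>, twice the constant \<open>12 * pi\<close> of the expansion
    estimate, so \<open>D\<close> doubles.\<close>
  then have "eventually (\<lambda>n. norm ((f ^^ n) z0) \<ge> max A (exp (ln R + 24 * pi))) sequentially"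
    unfolding filterlim_at_top by blast
  then obtain N where N: "\<And>n. n \<ge> N \<Longrightarrow> norm ((f ^^ n) z0) \<ge> max A (exp (ln R + 24 * pi))"
    unfolding eventually_sequentially by blast
  have sN: "s n \<ge> 24 * pi" if "n \<ge> N" for n
  proof -
    have "exp (ln R + 24 * pi) \<le> norm ((f ^^ n) z0)" using N[OF that] by simp
    then have "ln R + 24 * pi \<le> ln (norm ((f ^^ n) z0))" using nz[of n] by (subst ln_ge_iff) auto
    then show ?thesis by (simp add: s_def)
  qed
  have double: "2 ^ k * D N \<le> D (N + k)" for k
  proof (induction k)
    case (Suc k)
    have "24 * pi * D (N + k) \<le> s (Suc (N + k)) * D (N + k)"
      using sN[of "Suc (N + k)"] D_pos[of "N + k"] by (intro mult_right_mono) auto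
    also have "\<dots> \<le> 12 * pi * D (Suc (N + k))" by (rule grow)
    finally have "2 * D (N + k) \<le> D (Suc (N + k))" using pi_gt_zero by simp
    then show ?case using Suc by simp
  qed simp
  \<comment> \<open>The upper estimate is used at \<open>Suc n\<close>, so that the unbounded factor
    \<open>s (Suc n)\<close> cancels and a bound independent of \<open>n\<close> remains.\<close>
  have bounded: "D n \<le> 30 * pi / r" if "n \<ge> N" for n
  proof -
    have "s (Suc n) * D n \<le> 12 * pi * D (Suc n)" by (rule grow)
    also have "\<dots> \<le> 12 * pi * (5 / 2 * s (Suc n) / r)"
      using upper[of "Suc n"] N[of "Suc n"] that by (intro mult_left_mono) auto
    finally have "s (Suc n) * D n \<le> s (Suc n) * (30 * pi / r)" by (simp add: field_simps)
    then show ?thesis using s_pos[of "Suc n"] by (rule mult_left_le_imp_le)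
  qed
  obtain k where "30 * pi / r / D N < 2 ^ k" using real_arch_pow[of 2] by auto
  then have "30 * pi / r < 2 ^ k * D N" using D_pos[of N] pos_divide_less_eq by blast
  also have "\<dots> \<le> 30 * pi / r" using double[of k] bounded[of "N + k"] by simp
  finally show False by simp
qed

section \<open>The closure of the escaping set of the composition\<close>

text \<open>Since \<open>f\<close> commutes with \<open>f \<circ> g\<close>, the orbit of
  \<open>f z\<close> is the image under \<open>f\<close> of the orbit of \<open>z\<close>; as
  \<open>f\<close> is bounded on bounded sets, the former can tend to infinity only if the latter
  does.\<close>

lemma escaping_set_compose_preimage:
  assumes f: "continuous_on UNIV f" and comm: "f \<circ> g = g \<circ> f"
    and z: "f z \<in> escaping_set (f \<circ> g)"
  shows "z \<in> escaping_set (f \<circ> g)"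
proof -
  have c: "((f \<circ> g) ^^ n) (f z) = f (((f \<circ> g) ^^ n) z)" for n
  proof (induction n)
    case (Suc n)
    then show ?case using comm by (simp add: fun_eq_iff)
  qed simp
  have lim: "filterlim (\<lambda>n. f (((f \<circ> g) ^^ n) z)) at_infinity sequentially"
    using z by (simp add: escaping_set_def c)
  have "filterlim (\<lambda>n. ((f \<circ> g) ^^ n) z) at_infinity sequentially"
    unfolding filterlim_at_infinity[OF order_refl]
  proof (intro allI impI)
    fix M :: real
    have "bounded (f ` cball 0 M)"
      by (intro compact_imp_bounded compact_continuous_image compact_cball continuous_on_subset[OF f subset_UNIV])
    then obtain B where B: "B > 0" "\<And>x. norm x \<le> M \<Longrightarrow> norm (f x) \<le> B" by (auto simp: bounded_pos)
    have "eventually (\<lambda>n. B + 1 \<le> norm (f (((f \<circ> g) ^^ n) z))) sequentially"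
      using lim B(1) unfolding filterlim_at_infinity[OF order_refl] by auto
    then show "eventually (\<lambda>n. M \<le> norm (((f \<circ> g) ^^ n) z)) sequentially"
      by (rule eventually_mono) (use B(2) in \<open>smt (verit)\<close>)
  qed
  then show ?thesis by (simp add: escaping_set_def)
qed

text \<open>The complement \<open>F\<close> of the closure is invariant under \<open>f\<close>, so
  on a disc in \<open>F\<close> the iterates of \<open>f\<close> omit two points of the escaping set
  of \<open>f \<circ> g\<close>. No escaping point of \<open>f\<close> can lie there.\<close>

lemma escaping_set_subset_closure_compose:
  assumes "bounded_type f" "bounded_type g" and comm: "f \<circ> g = g \<circ> f"
  shows "escaping_set f \<subseteq> closure (escaping_set (f \<circ> g))"
proof
  fix z0 assume z0: "z0 \<in> escaping_set f"
  have f: "transcendental_entire f" using assms by (simp add: bounded_type_def)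
  then have hol: "f holomorphic_on UNIV" by (simp add: transcendental_entire_def entire_def)
  define I where "I = escaping_set (f \<circ> g)"
  obtain a where a: "a \<in> I" using escaping_set_compose_nonempty[OF assms(1,2)] unfolding I_def by blast
  \<comment> \<open>The second value to be omitted: it escapes together with \<open>a\<close>, and
    differs from \<open>a\<close> because an escaping point is not fixed.\<close>
  define b where "b = (f \<circ> g) a"
  have lim: "filterlim (\<lambda>n. ((f \<circ> g) ^^ n) a) at_infinity sequentially"
    using a by (simp add: I_def escaping_set_def)
  then have "filterlim (\<lambda>n. ((f \<circ> g) ^^ Suc n) a) at_infinity sequentially"
    by (rule filterlim_sequentially_Suc[of "\<lambda>n. ((f \<circ> g) ^^ n) a", THEN iffD2])
  moreover have "((f \<circ> g) ^^ Suc n) a = ((f \<circ> g) ^^ n) b" for n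
    by (simp only: funpow_Suc_right b_def o_apply)
  ultimately have "b \<in> I" unfolding I_def escaping_set_def mem_Collect_eq by (simp only:)
  have "a \<noteq> b"
  proof
    assume "a = b"
    then have fix_a: "(f \<circ> g) a = a" by (simp add: b_def)
    have "((f \<circ> g) ^^ n) a = a" for n
    proof (induction n)
      case (Suc n)
      then show ?case by (simp only: funpow.simps(2) o_apply[of "f \<circ> g"] fix_a)
    qed simp
    moreover have "norm a + 1 > 0" by (simp add: add_nonneg_pos)
    then have "eventually (\<lambda>n. norm a + 1 \<le> norm (((f \<circ> g) ^^ n) a)) sequentially"
      using lim unfolding filterlim_at_infinity[OF order_refl] by blast
    ultimately show False by simp
  qed
  define F where "F = - closure I"
  have preI: "f z \<notin> I" if "z \<notin> I" for z
    using escaping_set_compose_preimage[OF holomorphic_on_imp_continuous_on[OF hol] comm, of z] that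
    by (auto simp: I_def)
  have F_inv: "f z \<in> F" if "z \<in> F" for z
  proof -
    have "open F" unfolding F_def by (intro open_Compl closed_closure)
    have "\<not> f constant_on UNIV"
    proof
      assume "f constant_on UNIV"
      then obtain c where "\<And>z. f z = c" by (auto simp: constant_on_def)
      then have "\<forall>z. f z = poly [:c:] z" by simp
      then show False using f unfolding transcendental_entire_def by blast
    qed
    then have "open (f ` F)"
      using open_mapping_thm[OF hol open_UNIV connected_UNIV \<open>open F\<close>] by auto
    \<comment> \<open>An open set disjoint from \<open>I\<close> is disjoint from its closure, which
      is why openness of \<open>f\<close> is needed to stay in \<open>F\<close>.\<close>
    moreover have "f ` F \<inter> I = {}" using preI closure_subset[of I] by (auto simp: F_def)
    ultimately have "f ` F \<inter> closure I = {}" by (simp add: open_Int_closure_eq_empty)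
    then show ?thesis using that by (auto simp: F_def)
  qed
  show "z0 \<in> closure I"
  proof (rule ccontr)
    assume "z0 \<notin> closure I"
    then have "z0 \<in> F" by (simp add: F_def)
    obtain R where R: "R \<ge> 1" "norm (f 0) \<le> R" "critical_values f \<union> asymptotic_values f \<subseteq> cball 0 R"
      using bounded_type_radius[OF assms(1)] by blast
    have lim0: "filterlim (\<lambda>n. (f ^^ n) z0) at_infinity sequentially"
      using z0 by (simp add: escaping_set_def)
    then have "eventually (\<lambda>n. R + 1 \<le> norm ((f ^^ n) z0)) sequentially"
      using R(1) unfolding filterlim_at_infinity[OF order_refl] by auto
    then obtain N where N: "\<And>n. n \<ge> N \<Longrightarrow> R + 1 \<le> norm ((f ^^ n) z0)"
      unfolding eventually_sequentially by blast
    \<comment> \<open>Passing to a late iterate puts the whole forward orbit outside the disc of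
      radius \<open>R\<close> without leaving \<open>F\<close>.\<close>
    define y where "y = (f ^^ N) z0"
    have y: "(f ^^ n) y = (f ^^ (n + N)) z0" for n by (simp add: y_def funpow_add)
    have "y \<in> escaping_set f"
      unfolding escaping_set_def mem_Collect_eq y 
      by (rule filterlim_compose[OF lim0, of "\<lambda>n. n + N"]) (rule filterlim_add_const_nat_at_top)
    moreover have "norm ((f ^^ n) y) > R" for n using N[of "n + N"] by (simp add: y)
    moreover have "y \<in> F" unfolding y_def by (induction N) (use \<open>z0 \<in> F\<close> F_inv in auto)
    then obtain \<rho> where \<rho>: "\<rho> > 0" "ball y \<rho> \<subseteq> F"
      unfolding F_def by (metis closed_closure open_Compl open_contains_ball)
    moreover note \<open>a \<noteq> b\<close>
    ultimately obtain n z where n: "z \<in> ball y \<rho>" "(f ^^ n) z = a \<or> (f ^^ n) z = b"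
      using escaping_orbit_hits_two_points[OF f R(3,2,1)] by blast
    then have "(f ^^ n) z \<in> I" using a \<open>b \<in> I\<close> by auto
    moreover have "(f ^^ n) z \<in> F" by (induction n) (use \<rho>(2) n(1) F_inv in auto)
    ultimately show False using closure_subset[of I] by (auto simp: F_def)
  qed
qed

theorem theorem5:
  fixes f g :: "complex \<Rightarrow> complex"
  assumes "transcendental_entire f" and "transcendental_entire g"
    and "bounded_type f" and "bounded_type g"
    and "f \<circ> g = g \<circ> f"
  shows "closure (escaping_set f) \<union> closure (escaping_set g) \<subseteq> closure (escaping_set (f \<circ> g))"
proof -
  \<comment> \<open>The same inclusion with \<open>f\<close> and \<open>g\<close> exchanged;
    commutation identifies the two compositions.\<close>
  have "escaping_set g \<subseteq> closure (escaping_set (f \<circ> g))"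
    using escaping_set_subset_closure_compose[OF assms(4,3)] assms(5) by simp
  then show ?thesis
    using escaping_set_subset_closure_compose[OF assms(3-5)]
    by (simp add: closure_minimal)
qed

end
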